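(* Let $\pi, w \in S_n$ be permutations such that $Q(\pi) = Q(w)$, where $Q$ denotes the Robinson--Schensted recording tableau. Then the following holds. (1) $\pi$ and $w$ have the same steady-state time. (2) The shape of $\mathrm{SD}(\pi)$ equals the shape of $\mathrm{SD}(w)$. (3) $\pi$ is good if and only if $w$ is good.
   Context: Box-ball system (BBS). Boxes are indexed by $\mathbb{Z}$ from left to right. A BBS configuration (with $n$ balls) is a sequence $X$ indexed by $\mathbb{Z}$ in which each of $1,\dots,n$ (the balls) appears exactly once and every other entry is $e := n+1$ (an empty box). One BBS move transforms $X$ into $\mathrm{BB}(X)$: the balls $1,2,\dots,n$, in this order, each jump once, to the nearest box to the right of the ball that is empty at that moment (the box a ball leaves becomes empty). $\mathrm{BB}^t(X)$ is the result of $t$ BBS moves. A permutation $w = w_1\cdots w_n \in S_n$ (one-line notation) is regarded as the configuration with ball $w_i$ in box $i$ for $1\le i\le n$ and all other boxes empty. An increasing run of a configuration is a maximal contiguous (occupying consecutive boxes) increasing nonempty sequence of balls. A soliton is an increasing run that is preserved by all subsequent BBS moves (it remains an increasing run in all later configurations). A configuration is in steady state if every ball is contained in a soliton. Every box-ball system reaches steady state after finitely many moves, and then the sizes of the solitons weakly increase from left to right. The steady-state time of $w$ is the number of BBS moves required for $w$ to reach steady state, i.e. the least $t\ge 0$ such that $\mathrm{BB}^t(w)$ is in steady state. The soliton decomposition $\mathrm{SD}(w)$ is the tableau whose first (top) row is the rightmost soliton of a steady-state configuration $\mathrm{BB}^t(w)$, whose second row is the second rightmost soliton, and so on; its rows are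 increasing but its columns need not be. $P(w), Q(w)$ denote the Robinson--Schensted insertion and recording tableaux of $w$. A tableau is standard if its rows and columns are increasing and each of $1,\dots,n$ appears exactly once. A permutation $w$ is (BBS) good if $\mathrm{SD}(w)$ is a standard tableau. *)

theory Defs
  imports "HOL-Combinatorics.Permutations" "HOL-Library.Sublist"
begin

text \<open>A configuration with \<open>n\<close> balls is a function \<open>X :: int \<Rightarrow> nat\<close> taking each value in
  \<open>{1..n}\<close> exactly once and the value \<open>n + 1\<close> (an empty box) everywhere else.\<close>

definition perm_config :: "nat \<Rightarrow> (nat \<Rightarrow> nat) \<Rightarrow> int \<Rightarrow> nat" where
  "perm_config n w = (\<lambda>i. if 1 \<le> i \<and> i \<le> int n then w (nat i) else n + 1)"

definition ball_pos :: "(int \<Rightarrow> nat) \<Rightarrow> nat \<Rightarrow> int" where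
  "ball_pos X b = (THE i. X i = b)"

text \<open>The least element exists in a configuration: the set is nonempty and bounded below.\<close>

definition next_empty :: "nat \<Rightarrow> (int \<Rightarrow> nat) \<Rightarrow> int \<Rightarrow> int" where
  "next_empty n X i = (LEAST j. i < j \<and> X j = n + 1)"

definition jump :: "nat \<Rightarrow> nat \<Rightarrow> (int \<Rightarrow> nat) \<Rightarrow> int \<Rightarrow> nat" where
  "jump n b X = X(ball_pos X b := n + 1, next_empty n X (ball_pos X b) := b)"

definition BB :: "nat \<Rightarrow> (int \<Rightarrow> nat) \<Rightarrow> int \<Rightarrow> nat" where
  "BB n X = fold (jump n) [1..<n + 1] X"

text \<open>Runs are represented by their lists of balls, read from left to right. As every ball
  occurs only once, such a list determines the boxes it occupies.\<close>

definition contiguous_increasing :: "nat \<Rightarrow> (int \<Rightarrow> nat) \<Rightarrow> nat list \<Rightarrow> bool" where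
  "contiguous_increasing n X xs \<longleftrightarrow>
     xs \<noteq> [] \<and> set xs \<subseteq> {1..n} \<and> sorted_wrt (<) xs \<and>
     (\<exists>a. \<forall>k < length xs. X (a + int k) = xs ! k)"

definition increasing_run :: "nat \<Rightarrow> (int \<Rightarrow> nat) \<Rightarrow> nat list \<Rightarrow> bool" where
  "increasing_run n X xs \<longleftrightarrow>
     contiguous_increasing n X xs \<and>
     (\<forall>ys. contiguous_increasing n X ys \<and> sublist xs ys \<longrightarrow> ys = xs)"

definition soliton :: "nat \<Rightarrow> (int \<Rightarrow> nat) \<Rightarrow> nat list \<Rightarrow> bool" where
  "soliton n X xs \<longleftrightarrow> (\<forall>t. increasing_run n ((BB n ^^ t) X) xs)"

definition steady_state :: "nat \<Rightarrow> (int \<Rightarrow> nat) \<Rightarrow> bool" where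
  "steady_state n X \<longleftrightarrow> (\<forall>b \<in> {1..n}. \<exists>xs. soliton n X xs \<and> b \<in> set xs)"

definition steady_state_time :: "nat \<Rightarrow> (nat \<Rightarrow> nat) \<Rightarrow> nat" where
  "steady_state_time n w = (LEAST t. steady_state n ((BB n ^^ t) (perm_config n w)))"

text \<open>A tableau is the list of its rows, from top to bottom.\<close>

definition shape :: "nat list list \<Rightarrow> nat list" where
  "shape T = map length T"

definition solitons_right_to_left :: "nat \<Rightarrow> (int \<Rightarrow> nat) \<Rightarrow> nat list list" where
  "solitons_right_to_left n X =
     sorted_key_list_of_set (\<lambda>xs. - ball_pos X (hd xs)) {xs. soliton n X xs}"

text \<open>All steady-state configurations in the orbit of \<open>w\<close> have the same solitons in the same
  order; the first one is used here.\<close>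

definition SD :: "nat \<Rightarrow> (nat \<Rightarrow> nat) \<Rightarrow> nat list list" where
  "SD n w = solitons_right_to_left n ((BB n ^^ steady_state_time n w) (perm_config n w))"

text \<open>The first two conjuncts say that the shape is a partition. They hold automatically for a
  soliton decomposition, as soliton sizes weakly increase from left to right in steady state.\<close>

definition standard_tableau :: "nat \<Rightarrow> nat list list \<Rightarrow> bool" where
  "standard_tableau n T \<longleftrightarrow>
     sorted_wrt (\<ge>) (shape T) \<and> [] \<notin> set T \<and>
     (\<forall>r \<in> set T. sorted_wrt (<) r) \<and>
     (\<forall>i j. Suc i < length T \<and> j < length (T ! Suc i) \<longrightarrow> T ! i ! j < T ! Suc i ! j) \<and>
     distinct (concat T) \<and> set (concat T) = {1..n}"

definition good :: "nat \<Rightarrow> (nat \<Rightarrow> nat) \<Rightarrow> bool" where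
  "good n w \<longleftrightarrow> standard_tableau n (SD n w)"

text \<open>Robinson--Schensted row insertion; the second component is the bumped entry, if any.\<close>

fun row_insert :: "nat \<Rightarrow> nat list \<Rightarrow> nat list \<times> nat option" where
  "row_insert x [] = ([x], None)"
| "row_insert x (y # ys) =
     (if x < y then (x # ys, Some y)
      else let (zs, b) = row_insert x ys in (y # zs, b))"

text \<open>The second component is the index (from 0) of the row in which the new cell is created.\<close>

fun tableau_insert :: "nat \<Rightarrow> nat list list \<Rightarrow> nat list list \<times> nat" where
  "tableau_insert x [] = ([[x]], 0)"
| "tableau_insert x (r # rs) =
     (case row_insert x r of
        (r', None) \<Rightarrow> (r' # rs, 0)
      | (r', Some y) \<Rightarrow> let (T, i) = tableau_insert y rs in (r' # T, Suc i))"

definition add_cell :: "nat \<Rightarrow> nat \<Rightarrow> nat list list \<Rightarrow> nat list list" where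
  "add_cell k i T = (if i < length T then T[i := T ! i @ [k]] else T @ [[k]])"

definition RS :: "nat \<Rightarrow> (nat \<Rightarrow> nat) \<Rightarrow> nat list list \<times> nat list list" where
  "RS n w =
     fold (\<lambda>k (P, Q). let (P', i) = tableau_insert (w k) P in (P', add_cell k i Q))
       [1..<n + 1] ([], [])"

definition insertion_tableau :: "nat \<Rightarrow> (nat \<Rightarrow> nat) \<Rightarrow> nat list list" where
  "insertion_tableau n w = fst (RS n w)"

definition recording_tableau :: "nat \<Rightarrow> (nat \<Rightarrow> nat) \<Rightarrow> nat list list" where
  "recording_tableau n w = snd (RS n w)"

end

theory Submission
  imports Defs
begin

text \<open>A configuration is described by the list of the positions of the balls \<open>1, \<dots>, n\<close>. For a
permutation \<open>w\<close> this list is the one-line notation of its inverse, and by the symmetry of the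
Robinson--Schensted correspondence its insertion tableau is the recording tableau of \<open>w\<close>
(\<open>recording_tableau_eq_insert_inverse\<close>). Hence two permutations with the same recording tableau have
Knuth equivalent position lists.

A box-ball move runs through the position list from left to right and replaces every entry by the
next free box. An elementary Knuth relation concerns three consecutive balls, and a comparison of
their jumps shows that it is carried to an elementary Knuth relation, with the same boxes being
occupied afterwards. So the two position lists remain Knuth equivalent forever (\<open>knuth_eq_move\<close>).

It remains to see what Knuth equivalent position lists have in common. An elementary relation
exchanges two balls \<open>a\<close> and \<open>a + 1\<close> while ball \<open>a - 1\<close> or \<open>a + 2\<close> lies between them
(\<open>dual_step\<close>). This changes neither the occupied boxes nor the boxes where increasing runs start.
The tableau of all runs, read from right to left, just has \<open>a\<close> and \<open>a + 1\<close> exchanged; it keeps its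
shape, and it is standard iff it was standard before (\<open>standard_tableau_dual_step\<close>).

Steady state can be recognised from the run starts. If a ball that has jumped is regarded as larger
than all others, a jump from box \<open>p\<close> replaces the run start \<open>p\<close> by \<open>p + 1\<close> and changes nothing
else (\<open>run_starts_rotate\<close>). So the number of runs is constant and a ball can pass only to a run
further to the right. The sum over all balls of the index of the run that contains the ball is
therefore a bounded monovariant. It is eventually constant, and it is constant from some time on
iff the configuration at that time is steady (\<open>steady_state_conf_iff\<close>), in which case the solitons
are the runs. Since Knuth equivalent position lists have the same sums at all times, they reach
steady state together, and the comparison of the tableaux of runs at that time gives the rest.\<close>

section \<open>The recording tableau as an insertion tableau\<close>

abbreviation below :: "nat \<Rightarrow> nat list list \<Rightarrow> bool" where
  "below M T \<equiv> \<forall>r \<in> set T. \<forall>y \<in> set r. y < M"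

lemma row_insert_entries:
  "row_insert x r = (r', b) \<Longrightarrow> set r' \<union> set_option b = insert x (set r)"
proof (induction r arbitrary: r' b)
  case (Cons y ys)
  obtain zs c where z: "row_insert x ys = (zs, c)" by fastforce
  show ?case
  proof (cases "x < y")
    case True
    then have "r' = x # ys" "b = Some y" using Cons.prems by simp_all
    then show ?thesis by auto
  next
    case False
    then have "r' = y # zs" "b = c" using Cons.prems z by simp_all
    then have "set r' \<union> set_option b = insert y (set zs \<union> set_option c)" by simp
    also have "\<dots> = insert x (set (y # ys))"
      unfolding Cons.IH[OF z] by (simp add: insert_commute)
    finally show ?thesis .
  qed
qed auto

lemma tableau_insert_entries:
  "tableau_insert x T = (T', i) \<Longrightarrow> \<Union> (set ` set T') = insert x (\<Union> (set ` set T))"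
proof (induction T arbitrary: x T' i)
  case (Cons r rs)
  obtain r' b where rb: "row_insert x r = (r', b)" by fastforce
  have e: "set r' \<union> set_option b = insert x (set r)" by (rule row_insert_entries[OF rb])
  show ?case
  proof (cases b)
    case None
    then have "T' = r' # rs" "set r' = insert x (set r)" using Cons.prems rb e by simp_all
    then show ?thesis by simp
  next
    case (Some y)
    obtain T1 j where t: "tableau_insert y rs = (T1, j)" by fastforce
    have "T' = r' # T1" using Cons.prems rb Some t by simp
    then have "\<Union> (set ` set T') = set r' \<union> \<Union> (set ` set T1)" by simp
    also have "\<dots> = insert y (set r') \<union> \<Union> (set ` set rs)"
      unfolding Cons.IH[OF t] by (simp only: Un_insert_left Un_insert_right)
    also have "insert y (set r') = insert x (set r)" using e Some by simp
    finally show ?thesis by simp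
  qed
qed auto

lemma entries_add_cell:
  "\<Union> (set ` set (add_cell k i T)) = insert k (\<Union> (set ` set T))"
proof (cases "i < length T")
  case True
  have "\<Union> (set ` set (add_cell k i T)) = insert k (\<Union> (set ` set (take i T @ T ! i # drop (Suc i) T)))"
    using True by (simp add: add_cell_def upd_conv_take_nth_drop Un_assoc Un_left_commute)
  then show ?thesis using id_take_nth_drop[OF True] by metis
qed (simp add: add_cell_def)

lemma below_iff: "below M T \<longleftrightarrow> (\<forall>y \<in> \<Union> (set ` set T). y < M)"
  by blast

lemma row_insert_greatest: "\<forall>y \<in> set r. y < M \<Longrightarrow> row_insert M r = (r @ [M], None)"
  by (induction r) auto

lemma tableau_insert_greatest: "below M T \<Longrightarrow> tableau_insert M T = (add_cell M 0 T, 0)"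
  by (cases T) (auto simp: row_insert_greatest add_cell_def)

lemma row_insert_append_greatest:
  assumes "x < M" "row_insert x r = (r', b)"
  shows "row_insert x (r @ [M]) =
    (case b of None \<Rightarrow> (r', Some M) | Some y \<Rightarrow> (r' @ [M], Some y))"
  using assms(2)
proof (induction r arbitrary: r' b)
  case Nil
  then show ?case using assms(1) by auto
next
  case (Cons y ys)
  obtain zs c where z: "row_insert x ys = (zs, c)" by fastforce
  show ?case using Cons.prems Cons.IH[OF z] z by (auto split: if_splits option.splits)
qed

lemma tableau_insert_row_le:
  "tableau_insert x T = (T', i) \<Longrightarrow> i \<le> length T \<and> i < length T' \<and> length T' = max (length T) (Suc i)"
proof (induction T arbitrary: x T' i)
  case (Cons r rs)
  obtain r' b where rb: "row_insert x r = (r', b)" by fastforce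
  show ?case
  proof (cases b)
    case (Some y)
    obtain T1 j where t: "tableau_insert y rs = (T1, j)" by fastforce
    show ?thesis using Cons.prems rb Some t Cons.IH[OF t] by auto
  qed (use Cons.prems rb in auto)
qed auto

lemma length_add_cell: "i \<le> length T \<Longrightarrow> length (add_cell k i T) = max (length T) (Suc i)"
  by (simp add: add_cell_def)

lemma add_cell_Cons_Suc: "add_cell k (Suc i) (r # T) = r # add_cell k i T"
  by (simp add: add_cell_def)

lemma add_cell_Cons_0: "add_cell k 0 (r # T) = (r @ [k]) # T"
  by (simp add: add_cell_def)

text \<open>A cell holding a value \<open>M\<close> larger than everything else does not disturb an insertion until the
insertion wants to end exactly in that cell. Then the new entry takes the place of \<open>M\<close>, and
\<open>M\<close>, being maximal, comes to rest at the end of the next row. The lemma is used twice below, with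
opposite roles: for \<open>P\<close>, where \<open>M\<close> is the largest letter, and for \<open>Q\<close>, where \<open>M\<close> is the latest
time.\<close>

lemma tableau_insert_add_cell:
  assumes "below M T" "x < M" "tableau_insert x T = (T', i)" "r \<le> length T"
  shows "tableau_insert x (add_cell M r T) =
    (if i = r then (add_cell M (Suc r) T', Suc r) else (add_cell M r T', i))"
  using assms
proof (induction T arbitrary: x T' i r)
  case Nil
  then show ?case by (auto simp: add_cell_def)
next
  case (Cons s T)
  obtain s' b where sb: "row_insert x s = (s', b)" by fastforce
  show ?case
  proof (cases b)
    case None
    then have ti: "T' = s' # T" "i = 0" using Cons.prems sb by auto
    show ?thesis
    proof (cases r)
      case 0
      have "below M T" using Cons.prems(1) by simp
      then show ?thesis
        using 0 ti None row_insert_append_greatest[OF Cons.prems(2) sb]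
          tableau_insert_greatest[of T M]
        by (simp add: add_cell_Cons_0 add_cell_Cons_Suc)
    next
      case (Suc k)
      then show ?thesis using ti None sb by (simp add: add_cell_Cons_Suc)
    qed
  next
    case (Some y)
    obtain T1 j where t: "tableau_insert y T = (T1, j)" by fastforce
    have ti: "T' = s' # T1" "i = Suc j" using Cons.prems sb Some t by auto
    have yM: "y < M" using row_insert_entries[OF sb] Some Cons.prems(1,2) by auto
    show ?thesis
    proof (cases r)
      case 0
      then show ?thesis
        using ti Some t row_insert_append_greatest[OF Cons.prems(2) sb]
        by (simp add: add_cell_Cons_0)
    next
      case (Suc k)
      have IH: "tableau_insert y (add_cell M k T) =
        (if j = k then (add_cell M (Suc k) T1, Suc k) else (add_cell M k T1, j))"
        by (rule Cons.IH) (use Cons.prems yM t Suc in auto)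
      show ?thesis using Suc ti Some t sb IH by (simp add: add_cell_Cons_Suc)
    qed
  qed
qed

text \<open>The fold in the definition of \<open>RS\<close>, but over an arbitrary list of positions, so that letters can
be left out of the word while the others keep their times.\<close>

definition robinson_schensted :: "(nat \<Rightarrow> nat) \<Rightarrow> nat list \<Rightarrow> nat list list \<times> nat list list" where
  "robinson_schensted w js =
     fold (\<lambda>k (P, Q). let (P', i) = tableau_insert (w k) P in (P', add_cell k i Q)) js ([], [])"

lemma robinson_schensted_snoc:
  "robinson_schensted w (js @ [k]) =
    (let (P, Q) = robinson_schensted w js; (P', i) = tableau_insert (w k) P in (P', add_cell k i Q))"
  by (simp add: robinson_schensted_def case_prod_beta)

lemma robinson_schensted_entries:
  assumes "robinson_schensted w js = (P, Q)"
  shows "\<Union> (set ` set P) = w ` set js" "\<Union> (set ` set Q) = set js" "length P = length Q"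
proof -
  have "\<Union> (set ` set P) = w ` set js \<and> \<Union> (set ` set Q) = set js \<and> length P = length Q"
    using assms
  proof (induction js arbitrary: P Q rule: rev_induct)
    case Nil
    then show ?case by (simp add: robinson_schensted_def)
  next
    case (snoc k js)
    obtain P0 Q0 where 0: "robinson_schensted w js = (P0, Q0)" by fastforce
    obtain P1 i where 1: "tableau_insert (w k) P0 = (P1, i)" by fastforce
    have PQ: "P = P1" "Q = add_cell k i Q0" using snoc.prems 0 1 by (auto simp: robinson_schensted_snoc)
    have IH: "\<Union> (set ` set P0) = w ` set js" "\<Union> (set ` set Q0) = set js" "length P0 = length Q0"
      using snoc.IH[OF 0] by simp_all
    have "length P = length Q"
      using tableau_insert_row_le[OF 1] IH(3) by (simp add: PQ length_add_cell)
    then show ?case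
      unfolding PQ tableau_insert_entries[OF 1] entries_add_cell IH(1,2) by simp
  qed
  then show "\<Union> (set ` set P) = w ` set js" "\<Union> (set ` set Q) = set js" "length P = length Q"
    by simp_all
qed

text \<open>Adding the largest letter \<open>w p\<close> to a word amounts to inserting its time \<open>p\<close> into the recording
tableau: whenever the largest letter is bumped from one row to the next, the time of that bump is
bumped along in \<open>Q\<close>. In particular the cell of the largest letter in \<open>P\<close> is the cell created by
inserting \<open>p\<close> into \<open>Q\<close>, and this is the invariant that carries the induction over time.\<close>

lemma robinson_schensted_insert_greatest_letter:
  assumes "sorted_wrt (<) (js @ p # ks)" "\<forall>j \<in> set js \<union> set ks. w j < w p"
    "robinson_schensted w (js @ ks) = (P, Q)" "tableau_insert p Q = (Q', r)"
  shows "robinson_schensted w (js @ p # ks) = (add_cell (w p) r P, Q')"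
  using assms
proof (induction ks arbitrary: P Q Q' r rule: rev_induct)
  case Nil
  have "below (w p) P" "below p Q"
    using Nil.prems unfolding below_iff robinson_schensted_entries(1,2)[OF Nil.prems(3)[simplified]]
    by (auto simp: sorted_wrt_append)
  then show ?case
    using Nil.prems by (auto simp: robinson_schensted_snoc tableau_insert_greatest)
next
  case (snoc k ks)
  obtain P0 Q0 where 0: "robinson_schensted w (js @ ks) = (P0, Q0)" by fastforce
  obtain Q0' r0 where ins: "tableau_insert p Q0 = (Q0', r0)" by fastforce
  obtain P1 i where 1: "tableau_insert (w k) P0 = (P1, i)" by fastforce
  have PQ: "P = P1" "Q = add_cell k i Q0"
    using snoc.prems(3) 0 1 robinson_schensted_snoc[of w "js @ ks" k] by auto
  have srt: "sorted_wrt (<) (js @ p # ks)" "p < k" "\<forall>j \<in> set (js @ ks). j < k"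
    using snoc.prems(1) by (auto simp: sorted_wrt_append)
  have IH: "robinson_schensted w (js @ p # ks) = (add_cell (w p) r0 P0, Q0')"
    by (rule snoc.IH[OF srt(1) _ 0 ins]) (use snoc.prems in auto)
  have bP: "below (w p) P0"
    using snoc.prems(2) unfolding below_iff robinson_schensted_entries(1)[OF 0] by auto
  have bQ: "below k Q0"
    using srt unfolding below_iff robinson_schensted_entries(2)[OF 0] by auto
  have len: "length P0 = length Q0" by (rule robinson_schensted_entries(3)[OF 0])
  have r0: "r0 \<le> length P0" using tableau_insert_row_le[OF ins] len by simp
  have i: "i \<le> length Q0" using tableau_insert_row_le[OF 1] len by simp
  have stepP: "tableau_insert (w k) (add_cell (w p) r0 P0) =
      (if i = r0 then (add_cell (w p) (Suc r0) P1, Suc r0) else (add_cell (w p) r0 P1, i))"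
    by (rule tableau_insert_add_cell[OF bP _ 1 r0]) (use snoc.prems in auto)
  have stepQ: "tableau_insert p (add_cell k i Q0) =
      (if r0 = i then (add_cell k (Suc i) Q0', Suc i) else (add_cell k i Q0', r0))"
    by (rule tableau_insert_add_cell[OF bQ srt(2) ins i])
  show ?case
    using robinson_schensted_snoc[of w "js @ p # ks" k] IH stepP stepQ snoc.prems(4) PQ
    by (auto split: if_splits)
qed

lemma filter_insert_letter:
  fixes js :: "nat list" and w :: "nat \<Rightarrow> nat"
  assumes "sorted_wrt (<) js" "inj_on w (set js)" "p \<in> set js" "w p = Suc k"
  obtains as bs where "filter (\<lambda>j. w j \<le> Suc k) js = as @ p # bs"
    "filter (\<lambda>j. w j \<le> k) js = as @ bs"
proof -
  obtain xs ys where js: "js = xs @ p # ys" using assms(3) by (meson split_list)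
  have ne: "w j \<noteq> Suc k" if "j \<in> set xs \<union> set ys" for j
  proof
    assume "w j = Suc k"
    then have "j = p" using assms(2,4) that js by (auto simp: inj_on_def)
    then have "p \<in> set xs \<union> set ys" using that by simp
    moreover have "\<forall>x \<in> set xs. x < p" "\<forall>x \<in> set ys. p < x"
      using assms(1) js by (simp_all add: sorted_wrt_append)
    ultimately show False by (metis UnE less_irrefl)
  qed
  have eq: "filter (\<lambda>j. w j \<le> Suc k) zs = filter (\<lambda>j. w j \<le> k) zs" if "set zs \<subseteq> set xs \<union> set ys" for zs
    by (rule filter_cong) (use ne that in \<open>auto simp: le_Suc_eq\<close>)
  show ?thesis
    by (rule that[of "filter (\<lambda>j. w j \<le> k) xs" "filter (\<lambda>j. w j \<le> k) ys"])
      (use js assms(4) eq[of xs] eq[of ys] in auto)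
qed

definition insert_list :: "nat list \<Rightarrow> nat list list" where
  "insert_list xs = fold (\<lambda>x T. fst (tableau_insert x T)) xs []"

text \<open>The symmetry theorem of the Robinson--Schensted correspondence, obtained by adding the letters in
increasing order.\<close>

theorem recording_tableau_eq_insert_inverse:
  assumes w: "w permutes {1..n}"
  shows "recording_tableau n w = insert_list (map (inv w) [1..<n + 1])"
proof -
  have main: "snd (robinson_schensted w (filter (\<lambda>j. w j \<le> k) [1..<n + 1])) = insert_list (map (inv w) [1..<k + 1])"
    if "k \<le> n" for k
    using that
  proof (induction k)
    case 0
    have "w j \<noteq> 0" if "j \<in> {1..n}" for j
      using permutes_in_image[OF w, of j] that by (metis atLeastAtMost_iff not_one_le_zero)
    then have "filter (\<lambda>j. w j \<le> 0) [1..<n + 1] = []" by (auto simp: filter_empty_conv)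
    then show ?case by (simp add: robinson_schensted_def insert_list_def)
  next
    case (Suc k)
    define p where "p = inv w (Suc k)"
    have wp: "w p = Suc k" unfolding p_def by (rule permutes_inverses(1)[OF w])
    have pin: "p \<in> set [1..<n + 1]"
      using permutes_in_image[OF w, of p] wp Suc.prems by auto
    obtain as bs where f: "filter (\<lambda>j. w j \<le> Suc k) [1..<n + 1] = as @ p # bs"
      "filter (\<lambda>j. w j \<le> k) [1..<n + 1] = as @ bs"
      by (rule filter_insert_letter[of "[1..<n + 1]" w p k])
        (rule sorted_wrt_upt permutes_inj_on[OF w] pin wp)+
    obtain P Q where PQ: "robinson_schensted w (as @ bs) = (P, Q)" by fastforce
    obtain Q' r where ins: "tableau_insert p Q = (Q', r)" by fastforce
    have "sorted_wrt (<) (as @ p # bs)"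
      unfolding f(1)[symmetric] by (intro sorted_wrt_filter sorted_wrt_upt)
    moreover have "\<forall>j \<in> set (as @ bs). w j \<le> k" unfolding f(2)[symmetric] by simp
    then have "\<forall>j \<in> set as \<union> set bs. w j < w p" using wp by (simp add: less_Suc_eq_le)
    ultimately have "robinson_schensted w (as @ p # bs) = (add_cell (w p) r P, Q')"
      using robinson_schensted_insert_greatest_letter PQ ins by blast
    then show ?case
      using Suc f PQ ins by (simp add: insert_list_def p_def)
  qed
  have "\<forall>j \<in> set [1..<n + 1]. w j \<le> n"
  proof
    fix j assume "j \<in> set [1..<n + 1]"
    then have "w j \<in> {1..n}" by (simp only: permutes_in_image[OF w]) auto
    then show "w j \<le> n" by simp
  qed
  then have "filter (\<lambda>j. w j \<le> n) [1..<n + 1] = [1..<n + 1]" by (rule filter_True)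
  then have "snd (robinson_schensted w [1..<n + 1]) = insert_list (map (inv w) [1..<n + 1])"
    using main[OF le_refl] by (simp only:)
  then show ?thesis by (simp only: recording_tableau_def RS_def robinson_schensted_def)
qed

section \<open>Knuth equivalence\<close>

inductive knuth_eq :: "'a::linorder list \<Rightarrow> 'a list \<Rightarrow> bool" where
  bac: "a < b \<Longrightarrow> b < c \<Longrightarrow> knuth_eq (l @ [b, a, c] @ r) (l @ [b, c, a] @ r)"
| acb: "a < b \<Longrightarrow> b < c \<Longrightarrow> knuth_eq (l @ [a, c, b] @ r) (l @ [c, a, b] @ r)"
| refl: "knuth_eq u u"
| sym: "knuth_eq u v \<Longrightarrow> knuth_eq v u"
| trans: "knuth_eq u v \<Longrightarrow> knuth_eq v w \<Longrightarrow> knuth_eq u w"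

lemma knuth_eq_context: "knuth_eq u v \<Longrightarrow> knuth_eq (l @ u @ r) (l @ v @ r)"
proof (induction rule: knuth_eq.induct)
  case (bac a b c l' r')
  then show ?case using knuth_eq.bac[of a b c "l @ l'" "r' @ r"] by simp
next
  case (acb a b c l' r')
  then show ?case using knuth_eq.acb[of a b c "l @ l'" "r' @ r"] by simp
qed (blast intro: knuth_eq.intros(3-5))+

lemma knuth_eq_map:
  assumes "strict_mono f"
  shows "knuth_eq u v \<Longrightarrow> knuth_eq (map f u) (map f v)"
proof (induction rule: knuth_eq.induct)
  case (bac a b c l r)
  then show ?case
    using knuth_eq.bac[of "f a" "f b" "f c" "map f l" "map f r"] strict_monoD[OF assms] by simp
next
  case (acb a b c l r)
  then show ?case
    using knuth_eq.acb[of "f a" "f b" "f c" "map f l" "map f r"] strict_monoD[OF assms] by simp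
qed (blast intro: knuth_eq.intros(3-5))+

lemma knuth_eq_same_entries: "knuth_eq u v \<Longrightarrow> set u = set v \<and> distinct u = distinct v \<and> length u = length v"
  by (induction rule: knuth_eq.induct) auto

text \<open>The entry that is inserted into a row travels to the left, past all entries larger than the one
it bumps; each time, the left neighbour of the pair being swapped lies between its two entries.\<close>

lemma knuth_eq_move_left:
  assumes "sorted_wrt (<) (y # ys)" "x < y"
  shows "knuth_eq (y # ys @ [x]) (y # x # ys)"
  using assms
proof (induction ys arbitrary: y)
  case (Cons z zs)
  have "knuth_eq (z # zs @ [x]) (z # x # zs)" by (rule Cons.IH) (use Cons.prems in auto)
  then have "knuth_eq (y # z # zs @ [x]) (y # z # x # zs)"
    using knuth_eq_context[of _ _ "[y]" "[]"] by simp
  moreover have "knuth_eq (y # z # x # zs) (y # x # z # zs)"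
    by (rule knuth_eq.sym) (use knuth_eq.bac[of x y z "[]" zs] Cons.prems in simp)
  ultimately have "knuth_eq (y # z # zs @ [x]) (y # x # z # zs)" by (rule knuth_eq.trans)
  then show ?case by simp
qed (simp add: knuth_eq.refl)

lemma row_insert_None: "row_insert x r = (r', None) \<Longrightarrow> r' = r @ [x]"
proof (induction r arbitrary: r')
  case (Cons y ys)
  then show ?case by (cases "row_insert x ys") (auto split: if_splits)
qed auto

lemma row_insert_sorted:
  assumes "row_insert x r = (r', b)" "sorted_wrt (<) r" "x \<notin> set r"
  shows "sorted_wrt (<) r'"
  using assms
proof (induction r arbitrary: r')
  case (Cons y ys)
  obtain zs c where z: "row_insert x ys = (zs, c)" by fastforce
  show ?case
  proof (cases "x < y")
    case False
    have "sorted_wrt (<) zs" by (rule Cons.IH) (use z Cons.prems False in auto)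
    moreover have "y < u" if "u \<in> set zs" for u
    proof -
      have "u \<in> insert x (set ys)" using row_insert_entries[OF z] that by blast
      moreover have "y \<noteq> x" "\<forall>u \<in> set ys. y < u" using Cons.prems by simp_all
      ultimately show ?thesis using False by (metis insertE linorder_neqE_nat)
    qed
    moreover have "r' = y # zs" using Cons.prems z False by simp
    ultimately show ?thesis by simp
  next
    case True
    then have "r' = x # ys" "\<forall>u \<in> set ys. y < u" using Cons.prems by simp_all
    moreover have "\<forall>u \<in> set ys. x < u"
    proof
      fix u assume "u \<in> set ys"
      then have "y < u" using Cons.prems by simp
      then show "x < u" using True by simp
    qed
    ultimately show ?thesis using Cons.prems by simp
  qed
qed auto

text \<open>After the bump, the bumped entry travels to the front of the row; now the witness is the right
neighbour of the swapped pair. The bound on \<open>hd r'\<close> provides that witness in the induction.\<close>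

lemma row_insert_bump_knuth_eq:
  assumes "row_insert x r = (r', Some c)" "sorted_wrt (<) r" "x \<notin> set r"
  shows "knuth_eq (r @ [x]) (c # r') \<and> x < c \<and> r' \<noteq> [] \<and> hd r' \<le> x"
  using assms
proof (induction r arbitrary: r')
  case (Cons y ys)
  show ?case
  proof (cases "x < y")
    case True
    then show ?thesis using Cons.prems knuth_eq_move_left[of y ys x] by auto
  next
    case False
    obtain zs where z: "row_insert x ys = (zs, Some c)" "r' = y # zs"
      using Cons.prems False by (auto split: prod.splits)
    have IH: "knuth_eq (ys @ [x]) (c # zs)" "x < c" "zs \<noteq> []" "hd zs \<le> x"
      using Cons.IH[OF z(1)] Cons.prems by auto
    obtain h t where zs: "zs = h # t" using IH(3) by (cases zs) auto
    have "h \<in> insert x (set ys)" using row_insert_entries[OF z(1)] zs by auto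
    moreover have "y \<noteq> x" "\<forall>u \<in> set ys. y < u" using Cons.prems by simp_all
    ultimately have "y < h" using False by (metis insertE linorder_neqE_nat)
    moreover have "h < c" using IH zs by auto
    ultimately have "knuth_eq (y # c # zs) (c # y # zs)"
      using knuth_eq.acb[of y h c "[]" t] zs by simp
    moreover have "knuth_eq (y # ys @ [x]) (y # c # zs)"
      using knuth_eq_context[OF IH(1), of "[y]" "[]"] by simp
    ultimately have "knuth_eq (y # ys @ [x]) (c # y # zs)" by (rule knuth_eq.trans[rotated])
    then show ?thesis using z False Cons.prems IH(2) by simp
  qed
qed auto

lemma tableau_insert_knuth_eq:
  assumes "tableau_insert x T = (T', i)" "\<forall>r \<in> set T. sorted_wrt (<) r"
    "x \<notin> set (concat T)" "distinct (concat (rev T))"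
  shows "knuth_eq (concat (rev T) @ [x]) (concat (rev T')) \<and> (\<forall>r \<in> set T'. sorted_wrt (<) r)"
  using assms
proof (induction T arbitrary: x T' i)
  case Nil
  then have "T' = [[x]]" by simp
  then show ?case by (simp add: knuth_eq.refl)
next
  case (Cons r T)
  obtain r' b where rb: "row_insert x r = (r', b)" by fastforce
  have srt: "sorted_wrt (<) r'" by (rule row_insert_sorted[OF rb]) (use Cons.prems in auto)
  show ?case
  proof (cases b)
    case None
    then have "T' = (r @ [x]) # T" using Cons.prems rb row_insert_None[of x r r'] by simp
    then show ?thesis using Cons.prems rb row_insert_None[of x r r'] srt None
      by (simp add: knuth_eq.refl)
  next
    case (Some y)
    obtain T1 j where t: "tableau_insert y T = (T1, j)" by fastforce
    have k: "knuth_eq (r @ [x]) (y # r')" "x < y"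
      using row_insert_bump_knuth_eq[of x r r' y] rb Some Cons.prems by auto
    have "y \<in> set r" using row_insert_entries[OF rb] Some k(2) by auto
    then have IH: "knuth_eq (concat (rev T) @ [y]) (concat (rev T1)) \<and> (\<forall>r \<in> set T1. sorted_wrt (<) r)"
      by (intro Cons.IH[OF t]) (use Cons.prems in auto)
    have "knuth_eq (concat (rev T) @ r @ [x]) (concat (rev T) @ y # r')"
      using knuth_eq_context[OF k(1), of "concat (rev T)" "[]"] by simp
    moreover have "knuth_eq (concat (rev T) @ y # r') (concat (rev T1) @ r')"
      using knuth_eq_context[of "concat (rev T) @ [y]" "concat (rev T1)" "[]" r'] IH by simp
    ultimately have "knuth_eq (concat (rev T) @ r @ [x]) (concat (rev T1) @ r')"
      by (rule knuth_eq.trans)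
    moreover have "T' = r' # T1" using Cons.prems(1) rb Some t by simp
    ultimately show ?thesis using IH srt by simp
  qed
qed

lemma knuth_eq_reading_word:
  assumes "distinct xs"
  shows "knuth_eq xs (concat (rev (insert_list xs))) \<and> (\<forall>r \<in> set (insert_list xs). sorted_wrt (<) r)"
  using assms
proof (induction xs rule: rev_induct)
  case Nil
  then show ?case by (simp add: insert_list_def knuth_eq.refl)
next
  case (snoc x xs)
  let ?T = "insert_list xs"
  have IH: "knuth_eq xs (concat (rev ?T))" "\<forall>r \<in> set ?T. sorted_wrt (<) r"
    using snoc by auto
  obtain T' i where t: "tableau_insert x ?T = (T', i)" by fastforce
  have T': "insert_list (xs @ [x]) = T'" using t by (simp add: insert_list_def)
  have s: "set xs = set (concat (rev ?T))" "distinct (concat (rev ?T))"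
    using knuth_eq_same_entries[OF IH(1)] snoc.prems by auto
  have "knuth_eq (concat (rev ?T) @ [x]) (concat (rev T')) \<and> (\<forall>r \<in> set T'. sorted_wrt (<) r)"
    by (rule tableau_insert_knuth_eq[OF t IH(2)]) (use s snoc.prems in simp_all)
  moreover have "knuth_eq (xs @ [x]) (concat (rev ?T) @ [x])"
    using knuth_eq_context[OF IH(1), of "[]" "[x]"] by simp
  ultimately show ?case unfolding T' using knuth_eq.trans by blast
qed

theorem knuth_eq_if_insert_list_eq:
  assumes "distinct xs" "distinct ys" "insert_list xs = insert_list ys"
  shows "knuth_eq xs ys"
  using knuth_eq_reading_word[OF assms(1)] knuth_eq_reading_word[OF assms(2)] assms(3)
  by (metis knuth_eq.sym knuth_eq.trans)

section \<open>Box-ball moves on lists of ball positions\<close>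

definition next_free :: "int set \<Rightarrow> int \<Rightarrow> int" where
  "next_free S p = (LEAST j. p < j \<and> j \<notin> S)"

lemma next_free_eqI:
  assumes "p < q" "q \<notin> S" "\<And>j. p < j \<Longrightarrow> j < q \<Longrightarrow> j \<in> S"
  shows "next_free S p = q"
  unfolding next_free_def by (rule Least_equality) (use assms linorder_not_less in blast)+

lemma next_free_ex:
  fixes p :: int
  assumes "finite S"
  obtains q where "p < q" "q \<notin> S" "\<And>j. p < j \<Longrightarrow> j < q \<Longrightarrow> j \<in> S"
proof -
  obtain m :: nat where m: "\<forall>j \<in> S. j \<le> p + int m"
  proof -
    obtain M where "\<forall>j \<in> S. j \<le> M" using assms by (meson bdd_above.unfold bdd_above_finite)
    then have "\<forall>j \<in> S. j \<le> p + int (nat (M - p))" by fastforce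
    then show ?thesis using that by blast
  qed
  \<comment> \<open>The integers are not well-ordered, so the least free box is found by its distance from \<open>p\<close>.\<close>
  let ?P = "\<lambda>k::nat. p + 1 + int k \<notin> S"
  have "?P m" using m by fastforce
  define K where "K = (LEAST k. ?P k)"
  have L: "?P K" unfolding K_def by (rule LeastI) fact
  have full: "j \<in> S" if j: "p < j" "j < p + 1 + int K" for j
  proof (rule ccontr)
    assume "j \<notin> S"
    then have "?P (nat (j - p - 1))" using j by simp
    then have "K \<le> nat (j - p - 1)" unfolding K_def by (rule Least_le)
    then show False using j by linarith
  qed
  show ?thesis by (rule that[OF _ L full]) simp_all
qed

lemma next_free_props:
  assumes "finite S"
  shows "p < next_free S p" "next_free S p \<notin> S" "p < j \<Longrightarrow> j < next_free S p \<Longrightarrow> j \<in> S"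
proof -
  obtain q where q: "p < q" "q \<notin> S" "\<And>j. p < j \<Longrightarrow> j < q \<Longrightarrow> j \<in> S"
    using next_free_ex[OF assms, of p] by blast
  have "next_free S p = q" by (rule next_free_eqI[OF q])
  then show "p < next_free S p" "next_free S p \<notin> S" "p < j \<Longrightarrow> j < next_free S p \<Longrightarrow> j \<in> S"
    using q by auto
qed

text \<open>A list \<open>u\<close> stands for the configuration in which ball \<open>k + 1\<close> lies in box \<open>u ! k\<close>. The set \<open>S\<close> of
occupied boxes is carried separately because it also contains the balls outside the list.\<close>

fun jumps :: "int set \<Rightarrow> int list \<Rightarrow> int list" where
  "jumps S [] = []"
| "jumps S (p # ps) = next_free S p # jumps (insert (next_free S p) (S - {p})) ps"

definition move :: "int list \<Rightarrow> int list" where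
  "move u = jumps (set u) u"

lemma length_jumps [simp]: "length (jumps S u) = length u"
  by (induction S u rule: jumps.induct) auto

lemma jumps_distinct:
  assumes "finite S" "set u \<subseteq> S" "distinct u"
  shows "distinct (jumps S u) \<and> set (jumps S u) \<inter> (S - set u) = {}"
  using assms
proof (induction S u rule: jumps.induct)
  case (2 S p ps)
  let ?q = "next_free S p" and ?S = "insert (next_free S p) (S - {p})"
  have q: "?q \<notin> S" using next_free_props[OF 2(2)] by blast
  have IH: "distinct (jumps ?S ps) \<and> set (jumps ?S ps) \<inter> (?S - set ps) = {}"
    using 2 by auto
  have "?q \<in> ?S - set ps" using q 2(3) by auto
  moreover have "S - set (p # ps) \<subseteq> ?S - set ps" by auto
  ultimately show ?case using IH q by auto
qed auto

lemma jumps_append: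
  assumes "finite S" "set (u @ v) \<subseteq> S" "distinct (u @ v)"
  shows "jumps S (u @ v) = jumps S u @ jumps ((S - set u) \<union> set (jumps S u)) v"
  using assms
proof (induction S u rule: jumps.induct)
  case (2 S p ps)
  let ?q = "next_free S p" and ?S = "insert (next_free S p) (S - {p})"
  have q: "?q \<notin> S" using next_free_props[OF 2(2)] by blast
  have IH: "jumps ?S (ps @ v) = jumps ?S ps @ jumps ((?S - set ps) \<union> set (jumps ?S ps)) v"
    using 2 by auto
  have "?q \<notin> set ps" using q 2(3) by auto
  then have "(?S - set ps) \<union> set (jumps ?S ps)
      = (S - set (p # ps)) \<union> set (jumps S (p # ps))"
    by auto
  then show ?case using IH by simp
qed auto

lemma distinct_move: "distinct u \<Longrightarrow> distinct (move u)"
  unfolding move_def using jumps_distinct[of "set u" u] by simp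

lemma length_move [simp]: "length (move u) = length u"
  by (simp add: move_def)

text \<open>Three consecutive balls in positions \<open>b, a, c\<close> or \<open>b, c, a\<close> with \<open>a < b < c\<close>: the first one leaves
box \<open>b\<close> empty, so the ball from \<open>a\<close> lands at or before \<open>b\<close> and never meets the ball from \<open>c\<close>. The
last two jumps commute.\<close>

lemma jumps_bac:
  assumes S: "finite S" "a \<in> S" "b \<in> S" "c \<in> S" and abc: "a < b" "b < c"
  obtains a' b' c' where "a' < b'" "b' < c'"
    "jumps S [b, a, c] = [b', a', c']" "jumps S [b, c, a] = [b', c', a']"
proof -
  define b' where "b' = next_free S b"
  define S1 where "S1 = insert b' (S - {b})"
  have f1: "finite S1" using S by (simp add: S1_def)
  have b': "b < b'" "b' \<notin> S" "\<And>j. b < j \<Longrightarrow> j < b' \<Longrightarrow> j \<in> S"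
    unfolding b'_def using next_free_props[OF S(1), of b] by auto
  define a' where "a' = next_free S1 a"
  have a': "a < a'" "a' \<notin> S1" "\<And>j. a < j \<Longrightarrow> j < a' \<Longrightarrow> j \<in> S1"
    unfolding a'_def using next_free_props[OF f1, of a] by auto
  have ab: "a' \<le> b"
  proof (rule ccontr)
    assume "\<not> a' \<le> b"
    then have "b \<in> S1" using a'(3)[of b] abc by simp
    then show False using b'(1) by (simp add: S1_def)
  qed
  define c' where "c' = next_free S1 c"
  have c': "c < c'" "c' \<notin> S1" "\<And>j. c < j \<Longrightarrow> j < c' \<Longrightarrow> j \<in> S1"
    unfolding c'_def using next_free_props[OF f1, of c] by auto
  have "b' < c'"
  proof (rule ccontr)
    assume "\<not> b' < c'"
    moreover have "b' \<noteq> c'" using c'(2) by (auto simp: S1_def)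
    ultimately have "c' < b'" by simp
    then have "c' \<in> S" using b'(3)[of c'] c'(1) abc by simp
    then show False using c'(1,2) abc by (simp add: S1_def)
  qed
  moreover have "next_free (insert a' (S1 - {a})) c = c'"
    by (rule next_free_eqI) (use c' ab abc in auto)
  moreover have "next_free (insert c' (S1 - {c})) a = a'"
    by (rule next_free_eqI) (use a' c' ab abc in auto)
  ultimately show ?thesis
    using that[of a' b' c'] ab b'(1) by (simp add: a'_def b'_def c'_def S1_def)
qed

text \<open>The other Knuth relation may turn into the first one: if all boxes between \<open>a\<close> and \<open>c\<close> are full,
the ball from \<open>a\<close> reaches box \<open>c\<close> when \<open>c\<close> has been vacated before, and flies over \<open>c\<close>
otherwise.\<close>

lemma jumps_acb:
  assumes S: "finite S" "a \<in> S" "b \<in> S" "c \<in> S" and abc: "a < b" "b < c"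
  obtains a' b' c' where "a' < b'" "b' < c'"
    "jumps S [c, a, b] = [c', a', b']" "jumps S [a, c, b] = [a', c', b']"
  | a' b' c' where "a' < b'" "b' < c'"
    "jumps S [c, a, b] = [b', a', c']" "jumps S [a, c, b] = [b', c', a']"
proof -
  define r where "r = next_free S c"
  define S1 where "S1 = insert r (S - {c})"
  have f1: "finite S1" using S by (simp add: S1_def)
  have r: "c < r" "r \<notin> S" "\<And>j. c < j \<Longrightarrow> j < r \<Longrightarrow> j \<in> S"
    unfolding r_def using next_free_props[OF S(1), of c] by auto
  define p where "p = next_free S1 a"
  have p: "a < p" "p \<notin> S1" "\<And>j. a < j \<Longrightarrow> j < p \<Longrightarrow> j \<in> S1"
    unfolding p_def using next_free_props[OF f1, of a] by auto
  define S2 where "S2 = insert p (S1 - {a})"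
  have f2: "finite S2" using f1 by (simp add: S2_def)
  define q where "q = next_free S2 b"
  have q: "b < q" "q \<notin> S2" "\<And>j. b < j \<Longrightarrow> j < q \<Longrightarrow> j \<in> S2"
    unfolding q_def using next_free_props[OF f2, of b] by auto
  have X: "jumps S [c, a, b] = [r, p, q]" by (simp add: r_def p_def q_def S1_def S2_def)
  have pc: "p \<le> c"
  proof (rule ccontr)
    assume "\<not> p \<le> c"
    then have "c \<in> S1" using p(3)[of c] abc by simp
    then show False using r(1) by (simp add: S1_def)
  qed
  \<comment> \<open>The ball from \<open>a\<close> stops short of \<open>c\<close> iff some box between \<open>a\<close> and \<open>c\<close> is free.\<close>
  show ?thesis
  proof (cases "p = c")
    case False
    then have "p < c" using pc by simp
    have nS: "next_free S a = p"
      by (rule next_free_eqI) (use p \<open>p < c\<close> r in \<open>auto simp: S1_def\<close>)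
    have nr: "next_free (insert p (S - {a})) c = r"
      by (rule next_free_eqI) (use r \<open>p < c\<close> abc in auto)
    have S2': "insert r (insert p (S - {a}) - {c}) = S2"
      using \<open>p < c\<close> abc r(1) by (auto simp: S1_def S2_def)
    have Y: "jumps S [a, c, b] = [p, r, q]"
      by (simp add: nS nr S2' q_def)
    have "c \<notin> S2" using r(1) \<open>p < c\<close> by (simp add: S1_def S2_def)
    then have "q \<le> c" using q(3)[of c] abc by (metis linorder_not_le)
    moreover have "p < q"
    proof (rule ccontr)
      assume "\<not> p < q"
      moreover have "q \<noteq> p" using q(2) by (auto simp: S2_def)
      ultimately have "q < p" by simp
      then have "q \<in> S1" using p(3)[of q] q(1) abc by simp
      then show False using q(1,2) abc by (simp add: S2_def)
    qed
    ultimately show ?thesis by (intro that(1)[OF _ _ X Y]) (use r(1) in simp_all)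
  next
    case True
    have full: "j \<in> S" if "a < j" "j < r" for j
    proof (cases "j < c")
      case True
      then show ?thesis using p(3)[of j] that \<open>p = c\<close> r(1) by (simp add: S1_def)
    next
      case False
      then show ?thesis using r(3)[of j] that S by (cases "j = c") auto
    qed
    have nS: "next_free S a = r"
      by (rule next_free_eqI) (use full r abc in auto)
    have S2': "S2 = insert r (S - {a})"
      using True S abc r(1) by (auto simp: S1_def S2_def)
    have rq: "r < q"
    proof (rule ccontr)
      assume "\<not> r < q"
      moreover have "q \<noteq> r" using q(2) by (auto simp: S2')
      ultimately have "q \<in> S" using full[of q] q(1) abc by simp
      then show False using q(1,2) abc by (simp add: S2')
    qed
    have nq: "next_free (insert r (S - {a})) c = q"
      by (rule next_free_eqI) (use rq r q abc in \<open>auto simp: S2'\<close>)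
    have nc: "next_free (insert q (insert r (S - {a}) - {c})) b = c"
      by (rule next_free_eqI) (use rq r full abc in auto)
    have Y: "jumps S [a, c, b] = [r, q, c]"
      by (simp add: nS nq nc)
    show ?thesis by (rule that(2)[OF r(1) rq X[unfolded True] Y])
  qed
qed

text \<open>The balls after the triple see only the set of boxes that the triple leaves occupied.\<close>

lemma jumps_replace_triple:
  assumes "finite S" "set (l @ [b, a, c] @ r) \<subseteq> S" "distinct (l @ [b, a, c] @ r)"
    and "jumps ((S - set l) \<union> set (jumps S l)) [b, a, c] = x"
      "jumps ((S - set l) \<union> set (jumps S l)) [b', a', c'] = y"
    and "set [b', a', c'] = set [b, a, c]" "distinct [b', a', c']" "set x = set y"
  obtains l' r' where "jumps S (l @ [b, a, c] @ r) = l' @ x @ r'"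
    "jumps S (l @ [b', a', c'] @ r) = l' @ y @ r'"
proof -
  let ?S = "(S - set l) \<union> set (jumps S l)"
  have d: "distinct (l @ [b', a', c'] @ r)" "set (l @ [b', a', c'] @ r) \<subseteq> S"
    using assms(2,3,6,7) by (auto simp: distinct_append)
  have f: "finite ?S" using assms(1) by simp
  have sub: "set ([b, a, c] @ r) \<subseteq> ?S" "set ([b', a', c'] @ r) \<subseteq> ?S"
    using assms(2,3) d by auto
  have 1: "jumps S (l @ [b, a, c] @ r) = jumps S l @ x @ jumps ((?S - set [b, a, c]) \<union> set x) r"
    by (subst jumps_append[OF assms(1-3)], subst jumps_append[OF f sub(1)])
      (use assms(3) in \<open>simp_all add: assms(4) del: jumps.simps\<close>)
  have 2: "jumps S (l @ [b', a', c'] @ r) = jumps S l @ y @ jumps ((?S - set [b', a', c']) \<union> set y) r"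
    by (subst jumps_append[OF assms(1) d(2,1)], subst jumps_append[OF f sub(2)])
      (use d(1) in \<open>simp_all add: assms(5) del: jumps.simps\<close>)
  show ?thesis using that 1 2 unfolding assms(6,8) by blast
qed

text \<open>The heart of the argument. The balls before the triple jump in the same way on both sides, the
triple itself is the subject of \<open>jumps_bac\<close> and \<open>jumps_acb\<close>, and the balls after it meet the same
occupied boxes.\<close>

theorem knuth_eq_jumps:
  assumes "knuth_eq u v" "finite S" "set u \<subseteq> S" "distinct u"
  shows "knuth_eq (jumps S u) (jumps S v)"
  using assms
proof (induction rule: knuth_eq.induct)
  case (bac a b c l r)
  let ?S = "(S - set l) \<union> set (jumps S l)"
  have "a \<in> ?S" "b \<in> ?S" "c \<in> ?S" "finite ?S" using bac by auto
  then obtain x y z where xyz: "x < y" "y < z"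
    "jumps ?S [b, a, c] = [y, x, z]" "jumps ?S [b, c, a] = [y, z, x]"
    using jumps_bac[of ?S a b c] bac(1,2) by blast
  obtain l' r' where "jumps S (l @ [b, a, c] @ r) = l' @ [y, x, z] @ r'"
    "jumps S (l @ [b, c, a] @ r) = l' @ [y, z, x] @ r'"
    by (rule jumps_replace_triple[OF bac(3,4,5) xyz(3,4)]) (use bac(1,2) in auto)
  then show ?case using knuth_eq.bac[OF xyz(1,2)] by simp
next
  case (acb a b c l r)
  let ?S = "(S - set l) \<union> set (jumps S l)"
  have abc: "a \<in> ?S" "b \<in> ?S" "c \<in> ?S" "finite ?S" using acb by auto
  show ?case
  proof (rule jumps_acb[OF abc(4) abc(1,2,3) acb(1,2)])
    fix x y z assume xyz: "x < y" "y < z"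
      "jumps ?S [c, a, b] = [z, x, y]" "jumps ?S [a, c, b] = [x, z, y]"
    obtain l' r' where "jumps S (l @ [a, c, b] @ r) = l' @ [x, z, y] @ r'"
      "jumps S (l @ [c, a, b] @ r) = l' @ [z, x, y] @ r'"
      by (rule jumps_replace_triple[OF acb(3,4,5) xyz(4,3)]) (use acb(1,2) in auto)
    then show ?case using knuth_eq.acb[OF xyz(1,2)] by simp
  next
    fix x y z assume xyz: "x < y" "y < z"
      "jumps ?S [c, a, b] = [y, x, z]" "jumps ?S [a, c, b] = [y, z, x]"
    obtain l' r' where "jumps S (l @ [a, c, b] @ r) = l' @ [y, z, x] @ r'"
      "jumps S (l @ [c, a, b] @ r) = l' @ [y, x, z] @ r'"
      by (rule jumps_replace_triple[OF acb(3,4,5) xyz(4,3)]) (use acb(1,2) in auto)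
    then show ?case using knuth_eq.sym[OF knuth_eq.bac[OF xyz(1,2)]] by simp
  qed
next
  case (refl u)
  then show ?case by (simp add: knuth_eq.refl)
next
  case (sym u v)
  then show ?case using knuth_eq_same_entries[OF sym(1)] knuth_eq.sym by blast
next
  case (trans u v w)
  then show ?case using knuth_eq_same_entries[OF trans(1)] knuth_eq.trans by blast
qed

lemma knuth_eq_move:
  assumes "knuth_eq u v" "distinct u"
  shows "knuth_eq (move u) (move v)"
  using knuth_eq_jumps[OF assms(1), of "set u"] assms(2) knuth_eq_same_entries[OF assms(1)]
  by (simp add: move_def)

lemma funpow_move:
  assumes "distinct u"
  shows "distinct ((move ^^ t) u)" "length ((move ^^ t) u) = length u"
  by (induction t) (simp_all add: assms distinct_move)

lemma knuth_eq_funpow_move: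
  assumes "knuth_eq u v" "distinct u"
  shows "knuth_eq ((move ^^ t) u) ((move ^^ t) v)"
proof (induction t)
  case (Suc t)
  then show ?case using knuth_eq_move[OF Suc] funpow_move[OF assms(2)] by simp
qed (simp add: assms)

section \<open>Position lists as configurations\<close>

text \<open>For boxes outside \<open>u\<close> the value is \<open>length u + 1\<close>, which is the code for an empty box.\<close>

definition conf :: "int list \<Rightarrow> int \<Rightarrow> nat" where
  "conf u p = Suc (length (takeWhile (\<lambda>q. q \<noteq> p) u))"

lemma conf_Nil [simp]: "conf [] p = 1"
  by (simp add: conf_def)

lemma conf_Cons [simp]: "conf (q # u) p = (if q = p then 1 else Suc (conf u p))"
  by (simp add: conf_def)

lemma conf_greater_0: "0 < conf u p"
  by (simp add: conf_def)

lemma conf_notin: "p \<notin> set u \<Longrightarrow> conf u p = Suc (length u)"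
  by (induction u) auto

lemma conf_in_le: "p \<in> set u \<Longrightarrow> conf u p \<le> length u"
  by (induction u) auto

lemma conf_le: "conf u p \<le> Suc (length u)"
  using conf_notin[of p u] conf_in_le[of p u] by fastforce

lemma conf_in_iff: "conf u p \<le> length u \<longleftrightarrow> p \<in> set u"
  using conf_notin[of p u] conf_in_le[of p u] by fastforce

lemma conf_append:
  "conf (u @ v) p = (if p \<in> set u then conf u p else length u + conf v p)"
  by (induction u) auto

lemma nth_conf: "p \<in> set u \<Longrightarrow> u ! (conf u p - 1) = p"
proof (induction u)
  case (Cons q u)
  then show ?case using conf_greater_0[of u p] by (auto simp: nth_Cons')
qed simp

lemma conf_nth: "distinct u \<Longrightarrow> k < length u \<Longrightarrow> conf u (u ! k) = Suc k"
proof (induction u arbitrary: k)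
  case (Cons q u)
  then show ?case by (cases k) (auto simp: nth_mem)
qed simp

lemma conf_eq_iff:
  assumes "distinct u" "b \<in> {1..length u}"
  shows "conf u p = b \<longleftrightarrow> p = u ! (b - 1)"
proof
  assume "conf u p = b"
  then have "p \<in> set u" using assms(2) conf_in_iff by auto
  then show "p = u ! (b - 1)" using nth_conf \<open>conf u p = b\<close> by metis
next
  assume "p = u ! (b - 1)"
  then show "conf u p = b" using conf_nth[OF assms(1), of "b - 1"] assms(2) by auto
qed

lemma ball_pos_conf:
  assumes "distinct u" "b \<in> {1..length u}"
  shows "ball_pos (conf u) b = u ! (b - 1)"
  unfolding ball_pos_def conf_eq_iff[OF assms] by simp

lemma jump_conf:
  assumes "distinct (l @ p # r)" "n = length (l @ p # r)"
  shows "jump n (Suc (length l)) (conf (l @ p # r)) = conf (l @ next_free (set (l @ p # r)) p # r)"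
proof -
  let ?u = "l @ p # r" and ?q = "next_free (set (l @ p # r)) p"
  have b: "ball_pos (conf ?u) (Suc (length l)) = p"
    using ball_pos_conf[OF assms(1), of "Suc (length l)"] by simp
  have e: "conf ?u j = n + 1 \<longleftrightarrow> j \<notin> set ?u" for j
    using conf_notin[of j ?u] conf_in_le[of j ?u] assms(2) by auto
  have ne: "next_empty n (conf ?u) p = ?q"
    unfolding next_empty_def next_free_def e ..
  have q: "?q \<notin> set ?u" "p < ?q" using next_free_props[of "set ?u" p] by auto
  have "((conf ?u)(p := n + 1, ?q := Suc (length l))) j = conf (l @ ?q # r) j" for j
    using assms q conf_notin[of j r] by (auto simp: conf_append)
  then show ?thesis unfolding jump_def b ne by blast
qed

lemma fold_jump_conf:
  assumes "distinct (l @ r)" "n = length (l @ r)"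
  shows "fold (jump n) [Suc (length l)..<Suc n] (conf (l @ r)) = conf (l @ jumps (set (l @ r)) r)"
  using assms
proof (induction r arbitrary: l)
  case Nil
  then show ?case by simp
next
  case (Cons p r)
  let ?q = "next_free (set (l @ p # r)) p"
  have q: "?q \<notin> set (l @ p # r)" using next_free_props[of "set (l @ p # r)" p] by auto
  have IH: "fold (jump n) [Suc (length (l @ [?q]))..<Suc n] (conf ((l @ [?q]) @ r))
      = conf ((l @ [?q]) @ jumps (set ((l @ [?q]) @ r)) r)"
    by (rule Cons.IH) (use Cons.prems q in auto)
  have s: "set ((l @ [?q]) @ r) = insert ?q (set (l @ p # r) - {p})"
    using Cons.prems(1) q by auto
  have "[Suc (length l)..<Suc n] = Suc (length l) # [Suc (Suc (length l))..<Suc n]"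
    by (rule upt_conv_Cons) (use Cons.prems(2) in simp)
  then have "fold (jump n) [Suc (length l)..<Suc n] (conf (l @ p # r))
      = fold (jump n) [Suc (Suc (length l))..<Suc n] (conf (l @ ?q # r))"
    using jump_conf[OF Cons.prems] by simp
  also have "\<dots> = conf (l @ jumps (set (l @ p # r)) (p # r))"
    using IH unfolding s by simp
  finally show ?case .
qed

theorem BB_conf:
  assumes "distinct u" "n = length u"
  shows "BB n (conf u) = conf (move u)"
  using fold_jump_conf[of "[]" u n] assms by (simp add: BB_def move_def)

lemma funpow_BB_conf:
  assumes "distinct u" "n = length u"
  shows "(BB n ^^ t) (conf u) = conf ((move ^^ t) u)"
  by (induction t) (simp_all add: BB_conf funpow_move[OF assms(1)] assms(2))

section \<open>Run indices never decrease\<close>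

text \<open>As the empty box is the largest value, a box starts an increasing run iff its value is smaller
than the value to its left; in particular no empty box starts a run.\<close>

definition run_starts :: "int list \<Rightarrow> int set" where
  "run_starts u = {p. conf u p < conf u (p - 1)}"

definition run_index :: "int list \<Rightarrow> int \<Rightarrow> nat" where
  "run_index u p = card {s \<in> run_starts u. s \<le> p}"

lemma run_starts_subset: "run_starts u \<subseteq> set u"
proof
  fix p assume "p \<in> run_starts u"
  then have "conf u p < Suc (length u)"
    using conf_le[of u "p - 1"] by (simp add: run_starts_def)
  then show "p \<in> set u" using conf_in_iff[of u p] by simp
qed

lemma finite_run_starts [simp]: "finite (run_starts u)"
  using finite_subset[OF run_starts_subset] by blast

lemma run_index_mono: "p \<le> q \<Longrightarrow> run_index u p \<le> run_index u q"
  unfolding run_index_def by (rule card_mono) auto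

lemma run_index_less:
  assumes "p < s" "s \<le> q" "s \<in> run_starts u"
  shows "run_index u p < run_index u q"
  unfolding run_index_def
proof (rule psubset_card_mono)
  have "s \<in> {s \<in> run_starts u. s \<le> q}" "s \<notin> {s \<in> run_starts u. s \<le> p}" using assms by auto
  moreover have "{s \<in> run_starts u. s \<le> p} \<subseteq> {s \<in> run_starts u. s \<le> q}" using assms by auto
  ultimately show "{s \<in> run_starts u. s \<le> p} \<subset> {s \<in> run_starts u. s \<le> q}" by blast
qed simp

lemma run_index_step:
  assumes "p \<notin> run_starts u"
  shows "run_index u p = run_index u (p - 1)"
proof -
  have "{s \<in> run_starts u. s \<le> p} = {s \<in> run_starts u. s \<le> p - 1}"
  proof (rule Collect_cong)
    fix s
    show "(s \<in> run_starts u \<and> s \<le> p) = (s \<in> run_starts u \<and> s \<le> p - 1)"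
      using assms by (cases "s = p") auto
  qed
  then show ?thesis by (simp add: run_index_def)
qed

lemma run_index_le: "run_index u p \<le> card (run_starts u)"
  unfolding run_index_def by (rule card_mono) auto

text \<open>Distinct run starts have distinct run indices, and none exceeds the number of run starts.\<close>

lemma run_index_image_starts: "run_index u ` run_starts u = {1..card (run_starts u)}"
proof (rule card_subset_eq)
  have "inj_on (run_index u) (run_starts u)"
  proof (rule linorder_inj_onI)
    fix s s' assume "s < s'" "s' \<in> run_starts u"
    then show "run_index u s \<noteq> run_index u s'" using run_index_less[of s s' s' u] by simp
  qed auto
  then show "card (run_index u ` run_starts u) = card {1..card (run_starts u)}"
    by (simp add: card_image)
  have "1 \<le> run_index u s" if "s \<in> run_starts u" for s
    using run_index_less[of "s - 1" s s u] that by simp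
  then show "run_index u ` run_starts u \<subseteq> {1..card (run_starts u)}"
    using run_index_le by auto
qed simp

text \<open>Moving the first position to the end of the list means that the ball that has jumped counts as
the largest one from then on. With this convention a jump from box \<open>p\<close> affects the run starts only
at \<open>p\<close> and \<open>p + 1\<close>: box \<open>p\<close> becomes empty, and box \<open>p + 1\<close>, whether it was occupied or receives
the jumping ball, becomes a run start. At any other landing box nothing changes, because the
ball, now the largest, extends the run to its left. After all balls have jumped, the order of the
balls is the original one again.\<close>

lemma run_starts_rotate:
  fixes p :: int and ps :: "int list"
  assumes d: "distinct (p # ps)"
  defines "q \<equiv> next_free (set (p # ps)) p"
  shows "run_starts (ps @ [q]) = insert (p + 1) (run_starts (p # ps) - {p})"
    "p \<in> run_starts (p # ps)" "p + 1 \<notin> run_starts (p # ps)"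
proof -
  let ?n = "length ps"
  have q: "p < q" "q \<notin> set (p # ps)" "\<And>j. p < j \<Longrightarrow> j < q \<Longrightarrow> j \<in> set (p # ps)"
    unfolding q_def using next_free_props[of "set (p # ps)" p] by auto
  have p: "p \<notin> set ps" using d by simp
  have old: "conf (p # ps) j = (if j = p then 1 else Suc (conf ps j))" for j by simp
  have new: "conf (ps @ [q]) j = (if j \<in> set ps then conf ps j else if j = q then Suc ?n else Suc (Suc ?n))" for j
    by (simp add: conf_append)
  show "p \<in> run_starts (p # ps)"
    using conf_greater_0[of ps] by (simp add: run_starts_def)
  show "p + 1 \<notin> run_starts (p # ps)"
    by (simp add: run_starts_def)
  have "j \<in> run_starts (ps @ [q]) \<longleftrightarrow> j = p + 1 \<or> (j \<in> run_starts (p # ps) \<and> j \<noteq> p)" for j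
  proof -
    consider "j = p" | "j = p + 1" | "j \<noteq> p" "j - 1 \<noteq> p" by force
    then show ?thesis
    proof cases
      case 1
      have "conf (ps @ [q]) p = Suc (Suc ?n)" using q p by (simp add: new)
      then show ?thesis using 1 conf_le[of "ps @ [q]" "p - 1"] by (simp add: run_starts_def)
    next
      case 2
      have "conf (ps @ [q]) p = Suc (Suc ?n)" using q p by (simp add: new)
      moreover have "p + 1 \<in> set ps \<or> p + 1 = q" using q(1) q(3)[of "p + 1"] by fastforce
      then have "conf (ps @ [q]) (p + 1) < Suc (Suc ?n)"
        using conf_in_le[of "p + 1" ps] by (auto simp: new)
      ultimately show ?thesis using 2 by (simp add: run_starts_def)
    next
      case 3
      have R: "j \<in> run_starts (p # ps) \<longleftrightarrow> conf ps j < conf ps (j - 1)"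
        using 3 by (simp add: run_starts_def)
      have "j - 1 \<in> set ps" if "j = q"
        using q(1) q(3)[of "j - 1"] that 3 by auto
      then have "conf (ps @ [q]) j < conf (ps @ [q]) (j - 1) \<longleftrightarrow> conf ps j < conf ps (j - 1)"
        using conf_in_le[of j ps] conf_in_le[of "j - 1" ps] conf_notin[of j ps] conf_notin[of "j - 1" ps] q(2)
        unfolding new by auto
      then show ?thesis using 3 R by (auto simp: run_starts_def)
    qed
  qed
  then show "run_starts (ps @ [q]) = insert (p + 1) (run_starts (p # ps) - {p})" by blast
qed

lemma run_index_rotate:
  fixes p x :: int
  assumes d: "distinct (p # ps)" and x: "x \<noteq> p"
  shows "run_index (ps @ [next_free (set (p # ps)) p]) x = run_index (p # ps) x"
proof (cases "x < p")
  case True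
  have "{s \<in> insert (p + 1) (run_starts (p # ps) - {p}). s \<le> x} = {s \<in> run_starts (p # ps). s \<le> x}"
    using True by auto
  then show ?thesis unfolding run_index_def run_starts_rotate(1)[OF d] by simp
next
  case False
  let ?A = "{s \<in> run_starts (p # ps). s \<le> x}"
  have A: "finite ?A" "p \<in> ?A" "p + 1 \<notin> ?A" using False run_starts_rotate(2,3)[OF d] by simp_all
  have "{s \<in> insert (p + 1) (run_starts (p # ps) - {p}). s \<le> x} = insert (p + 1) (?A - {p})"
    using False x by auto
  then have "run_index (ps @ [next_free (set (p # ps)) p]) x = card (insert (p + 1) (?A - {p}))"
    unfolding run_index_def run_starts_rotate(1)[OF d] by simp
  also have "\<dots> = Suc (card (?A - {p}))" using A by (subst card_insert_disjoint) simp_all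
  also have "\<dots> = card ?A" using A by (simp only: card_Suc_Diff1)
  finally show ?thesis by (simp add: run_index_def)
qed

text \<open>By \<open>run_index_rotate\<close> only the jumping ball can change its run, and it moves to the right.\<close>

lemma run_index_jumps:
  assumes "distinct (l @ m)"
  defines "v \<equiv> m @ jumps (set (l @ m)) l"
  shows "(\<forall>k < length l. run_index (l @ m) (l ! k) \<le> run_index v (jumps (set (l @ m)) l ! k)) \<and>
    (\<forall>x \<in> set m. run_index v x = run_index (l @ m) x) \<and>
    card (run_starts v) = card (run_starts (l @ m))"
  using assms(1) unfolding v_def
proof (induction l arbitrary: m)
  case Nil
  then show ?case by simp
next
  case (Cons p l)
  let ?u = "p # (l @ m)"
  define q where "q = next_free (set ?u) p"
  define v where "v = (m @ [q]) @ jumps (set (l @ m @ [q])) l"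
  have d: "distinct ?u" using Cons.prems by simp
  have q: "p < q" "q \<notin> set ?u" unfolding q_def using next_free_props[of "set ?u" p] by auto
  have s: "set (l @ m @ [q]) = insert q (set ?u - {p})" using d by auto
  have v': "jumps (set ?u) (p # l) = q # jumps (set (l @ m @ [q])) l"
    unfolding s by (simp add: q_def)
  have IH: "\<forall>k < length l. run_index (l @ m @ [q]) (l ! k) \<le> run_index v (jumps (set (l @ m @ [q])) l ! k)"
    "\<forall>x \<in> set (m @ [q]). run_index v x = run_index (l @ m @ [q]) x"
    "card (run_starts v) = card (run_starts (l @ m @ [q]))"
    using Cons.IH[of "m @ [q]"] d q unfolding v_def by auto
  have rot: "run_index (l @ m @ [q]) x = run_index ?u x" if "x \<noteq> p" for x
    using run_index_rotate[OF d that] by (simp add: q_def)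
  have "run_index ?u ((p # l) ! k) \<le> run_index v ((q # jumps (set (l @ m @ [q])) l) ! k)"
    if "k < length (p # l)" for k
  proof (cases k)
    case 0
    have "run_index ?u p \<le> run_index ?u q" by (rule run_index_mono) (use q in simp)
    also have "\<dots> = run_index v q" using IH(2) rot[of q] q by simp
    finally show ?thesis using 0 by simp
  next
    case (Suc i)
    then have "l ! i \<noteq> p" using that d by auto
    then have "run_index ?u (l ! i) = run_index (l @ m @ [q]) (l ! i)" by (rule rot[symmetric])
    also have "\<dots> \<le> run_index v (jumps (set (l @ m @ [q])) l ! i)"
      by (rule IH(1)[rule_format]) (use Suc that in simp)
    finally show ?thesis using Suc by simp
  qed
  moreover have "run_index v x = run_index ?u x" if "x \<in> set m" for x
    using IH(2) rot[of x] that d by auto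
  moreover have "card (run_starts v) = card (run_starts ?u)"
  proof -
    have "run_starts (l @ m @ [q]) = insert (p + 1) (run_starts ?u - {p})"
      using run_starts_rotate(1)[OF d] by (simp add: q_def)
    also have "card \<dots> = Suc (card (run_starts ?u - {p}))"
      using run_starts_rotate(3)[OF d] by (subst card_insert_disjoint) simp_all
    also have "\<dots> = card (run_starts ?u)"
      using run_starts_rotate(2)[OF d] by (simp only: card_Suc_Diff1 finite_run_starts)
    finally show ?thesis using IH(3) by simp
  qed
  moreover have "jumps (set ((p # l) @ m)) (p # l) = q # jumps (set (l @ m @ [q])) l"
    using v' by (simp only: append_Cons)
  moreover have "m @ (q # jumps (set (l @ m @ [q])) l) = v" by (simp add: v_def)
  ultimately show ?case by (simp only: append_Cons) blast
qed

lemma run_index_move: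
  assumes "distinct u"
  shows "k < length u \<Longrightarrow> run_index u (u ! k) \<le> run_index (move u) (move u ! k)"
    "card (run_starts (move u)) = card (run_starts u)"
  using run_index_jumps[of u "[]"] assms by (simp_all add: move_def)

text \<open>A bounded monovariant of the moves, which depends only on the occupied boxes and the run starts.
It stays constant iff no ball ever changes its run.\<close>

definition index_sum :: "int list \<Rightarrow> nat" where
  "index_sum u = (\<Sum>p \<in> set u. run_index u p)"

lemma index_sum_nth:
  assumes "distinct u"
  shows "index_sum u = (\<Sum>k<length u. run_index u (u ! k))"
  unfolding index_sum_def
  by (rule sum.reindex_bij_betw[symmetric, OF bij_betw_nth[OF assms]]) auto

lemma index_sum_le:
  assumes "distinct u"
  shows "index_sum u \<le> length u * length u"
proof -
  have "card (run_starts u) \<le> length u"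
    using card_mono[OF _ run_starts_subset[of u]] card_length[of u] by simp
  then have "run_index u x \<le> length u" for x using run_index_le[of u x] by simp
  then show ?thesis
    unfolding index_sum_nth[OF assms] using sum_bounded_above[of "{..<length u}" "\<lambda>k. run_index u (u ! k)" "length u"] by simp
qed

lemma index_sum_move:
  assumes "distinct u"
  shows "index_sum u \<le> index_sum (move u)"
    "index_sum u = index_sum (move u) \<longleftrightarrow> (\<forall>k < length u. run_index u (u ! k) = run_index (move u) (move u ! k))"
proof -
  have e: "index_sum u = (\<Sum>k<length u. run_index u (u ! k))"
    "index_sum (move u) = (\<Sum>k<length u. run_index (move u) (move u ! k))"
    using index_sum_nth[OF assms] index_sum_nth[OF distinct_move[OF assms]] by simp_all
  show "index_sum u \<le> index_sum (move u)"
    unfolding e by (rule sum_mono) (simp add: run_index_move[OF assms])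
  show "index_sum u = index_sum (move u) \<longleftrightarrow> (\<forall>k < length u. run_index u (u ! k) = run_index (move u) (move u ! k))"
  proof
    assume "index_sum u = index_sum (move u)"
    then have "(\<Sum>k<length u. run_index u (u ! k)) = (\<Sum>k<length u. run_index (move u) (move u ! k))"
      unfolding e .
    then show "\<forall>k < length u. run_index u (u ! k) = run_index (move u) (move u ! k)"
      using sum_mono_inv[of "\<lambda>k. run_index u (u ! k)" "{..<length u}" "\<lambda>k. run_index (move u) (move u ! k)"]
        run_index_move[OF assms] by simp
  qed (simp add: e)
qed

definition settled :: "int list \<Rightarrow> bool" where
  "settled u \<longleftrightarrow> (\<forall>t. index_sum ((move ^^ t) u) = index_sum u)"

lemma eventually_settled:
  assumes "distinct u"
  shows "\<exists>t. settled ((move ^^ t) u)"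
proof -
  let ?f = "\<lambda>t. index_sum ((move ^^ t) u)"
  have mono: "?f s \<le> ?f t" if "s \<le> t" for s t
    using that
  proof (induction rule: dec_induct)
    case (step t)
    then show ?case using index_sum_move(1)[of "(move ^^ t) u"] funpow_move[OF assms] by simp
  qed simp
  have "?f t \<le> length u * length u" for t
    using index_sum_le[of "(move ^^ t) u"] funpow_move[OF assms] by simp
  then obtain T where T: "\<And>t. ?f t \<le> ?f T"
    using ex_has_greatest_nat[of "\<lambda>_. True" 0 ?f "Suc (length u * length u)"]
    by (metis less_Suc_eq_le)
  have "settled ((move ^^ T) u)"
    unfolding settled_def
  proof
    fix t
    have "?f (t + T) = ?f T" using T[of "t + T"] mono[of T "t + T"] by simp
    then show "index_sum ((move ^^ t) ((move ^^ T) u)) = index_sum ((move ^^ T) u)"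
      by (simp add: funpow_add)
  qed
  then show ?thesis by blast
qed

lemma settled_run_index:
  assumes "distinct u" "settled u" "k < length u"
  shows "run_index ((move ^^ t) u) ((move ^^ t) u ! k) = run_index u (u ! k)"
proof (induction t)
  case (Suc t)
  let ?v = "(move ^^ t) u"
  have "index_sum ?v = index_sum (move ?v)"
    using assms(2)[unfolded settled_def, rule_format, of t]
      assms(2)[unfolded settled_def, rule_format, of "Suc t"] by simp
  then have "run_index ?v (?v ! k) = run_index (move ?v) (move ?v ! k)"
    using index_sum_move(2)[of ?v] funpow_move[OF assms(1)] assms(3) by simp
  then show ?case using Suc by simp
qed simp

section \<open>Steady state\<close>

definition run_balls :: "int list \<Rightarrow> nat \<Rightarrow> nat set" where
  "run_balls u j = {b \<in> {1..length u}. run_index u (u ! (b - 1)) = j}"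

lemma finite_run_balls [simp]: "finite (run_balls u j)"
  by (simp add: run_balls_def)

text \<open>Boxes with equal run index have no run start between them; hence no empty box either if the last
one is occupied.\<close>

lemma same_run_conf_mono:
  assumes "run_index u p = run_index u q" "p \<le> i" "i \<le> j" "j \<le> q"
  shows "conf u i \<le> conf u j"
  using assms(3,4)
proof (induction j rule: int_ge_induct)
  case (step j)
  have "j + 1 \<notin> run_starts u" using run_index_less[of p "j + 1" q u] assms(1,2) step by auto
  then show ?case using step by (simp add: run_starts_def)
qed simp

lemma conf_inj:
  "conf u p = conf u q \<Longrightarrow> p \<in> set u \<Longrightarrow> p = q"
  using nth_conf[of p u] nth_conf[of q u] conf_in_iff[of u p] conf_in_iff[of u q] by simp

lemma contiguous_same_run:
  assumes "distinct u" "contiguous_increasing (length u) (conf u) xs"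
  obtains j where "set xs \<subseteq> run_balls u j"
proof -
  obtain a where xs: "set xs \<subseteq> {1..length u}" "sorted_wrt (<) xs"
    and a: "\<And>k. k < length xs \<Longrightarrow> conf u (a + int k) = xs ! k"
    using assms(2) by (auto simp: contiguous_increasing_def)
  have r: "run_index u (a + int k) = run_index u a" if "k < length xs" for k
    using that
  proof (induction k)
    case (Suc k)
    have "conf u (a + int k) = xs ! k" "conf u (a + int (Suc k)) = xs ! Suc k"
      using Suc.prems by (intro a; simp)+
    moreover have "xs ! k < xs ! Suc k" using xs(2) Suc.prems by (simp add: sorted_wrt_nth_less)
    ultimately have "conf u (a + int k) < conf u (a + int (Suc k))" by (simp only:)
    moreover have "a + int (Suc k) - 1 = a + int k" by simp
    ultimately have "a + int (Suc k) \<notin> run_starts u" unfolding run_starts_def by (metis (mono_tags) less_asym mem_Collect_eq)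
    then show ?case using run_index_step[of "a + int (Suc k)" u] Suc by simp
  qed simp
  have "set xs \<subseteq> run_balls u (run_index u a)"
  proof
    fix b assume "b \<in> set xs"
    then obtain k where k: "k < length xs" "b = xs ! k" by (metis in_set_conv_nth)
    have b: "b \<in> {1..length u}" using \<open>b \<in> set xs\<close> xs(1) by blast
    have "u ! (b - 1) = a + int k" using conf_eq_iff[OF assms(1) b, of "a + int k"] a k by simp
    then show "b \<in> run_balls u (run_index u a)" using b r k by (simp add: run_balls_def)
  qed
  then show ?thesis using that by blast
qed

lemma run_contiguous:
  assumes "distinct u" "run_balls u j \<noteq> {}"
  shows "contiguous_increasing (length u) (conf u) (sorted_list_of_set (run_balls u j))"
proof -
  define C where "C = {p \<in> set u. run_index u p = j}"
  have conf_C: "conf u ` C = run_balls u j"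
  proof (intro equalityI subsetI)
    fix b assume "b \<in> conf u ` C"
    then obtain p where "p \<in> set u" "run_index u p = j" "b = conf u p" by (auto simp: C_def)
    then show "b \<in> run_balls u j"
      using nth_conf[of p u] conf_in_le[of p u] conf_greater_0[of u p] by (simp add: run_balls_def)
  next
    fix b assume b: "b \<in> run_balls u j"
    then have "b - 1 < length u" by (auto simp: run_balls_def)
    then have "u ! (b - 1) \<in> C" using b by (simp add: C_def run_balls_def)
    moreover have "conf u (u ! (b - 1)) = b" using conf_nth[OF assms(1) \<open>b - 1 < length u\<close>] b
      by (auto simp: run_balls_def)
    ultimately show "b \<in> conf u ` C" by force
  qed
  have C: "finite C" "C \<noteq> {}" using assms(2) conf_C by (auto simp: C_def)
  define a where "a = Min C"
  define z where "z = Max C"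
  have az: "a \<in> C" "z \<in> C" "\<And>p. p \<in> C \<Longrightarrow> a \<le> p \<and> p \<le> z"
    unfolding a_def z_def using C by simp_all
  have ri: "run_index u a = run_index u z" using az by (simp add: C_def)
  have iC: "i \<in> C" if "a \<le> i" "i \<le> z" for i
  proof -
    have "conf u i \<le> conf u z" by (rule same_run_conf_mono[OF ri]) (use that in auto)
    then have "i \<in> set u" using az(2) conf_in_iff[of u z] conf_in_iff[of u i] by (simp add: C_def)
    moreover have "run_index u i = j"
      using run_index_mono[OF that(1), of u] run_index_mono[OF that(2), of u] az by (simp add: C_def)
    ultimately show ?thesis by (simp add: C_def)
  qed
  have strict: "conf u i < conf u i'" if "a \<le> i" "i < i'" "i' \<le> z" for i i'
  proof -
    have "conf u i \<le> conf u i'" by (rule same_run_conf_mono[OF ri]) (use that in auto)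
    moreover have "conf u i \<noteq> conf u i'"
      using conf_inj[of u i i'] iC[of i] that by (auto simp: C_def)
    ultimately show ?thesis by simp
  qed
  define m where "m = nat (z - a + 1)"
  define ys where "ys = map (\<lambda>k. conf u (a + int k)) [0..<m]"
  have "C = (\<lambda>k. a + int k) ` {0..<m}"
  proof (intro equalityI subsetI)
    fix p assume "p \<in> C"
    then have "a \<le> p" "p \<le> z" using az by auto
    then have "p = a + int (nat (p - a))" "nat (p - a) < m" by (auto simp: m_def)
    then show "p \<in> (\<lambda>k. a + int k) ` {0..<m}" by force
  next
    fix p assume "p \<in> (\<lambda>k. a + int k) ` {0..<m}"
    then show "p \<in> C" by (intro iC) (auto simp: m_def)
  qed
  then have set_ys: "set ys = run_balls u j" unfolding conf_C[symmetric] ys_def by auto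
  have srt: "sorted_wrt (<) ys"
    unfolding ys_def sorted_wrt_map sorted_wrt_iff_nth_less
    by (auto simp: m_def intro!: strict)
  have "sorted_list_of_set (set ys) = ys"
    using srt by (simp add: strict_sorted_iff sorted_list_of_set.idem_if_sorted_distinct)
  then have eq: "sorted_list_of_set (run_balls u j) = ys" using set_ys by simp
  have "m > 0" using az by (auto simp: m_def)
  moreover have "set ys \<subseteq> {1..length u}" unfolding set_ys by (auto simp: run_balls_def)
  ultimately show ?thesis
    unfolding eq contiguous_increasing_def using srt by (auto simp: ys_def)
qed

text \<open>Boxes with a common run index that hold balls form an interval, with values increasing to the right.\<close>

theorem increasing_run_conf_iff:
  assumes "distinct u"
  shows "increasing_run (length u) (conf u) xs \<longleftrightarrow>
    (\<exists>j. run_balls u j \<noteq> {} \<and> xs = sorted_list_of_set (run_balls u j))"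
proof
  assume R: "increasing_run (length u) (conf u) xs"
  then have c: "contiguous_increasing (length u) (conf u) xs" by (simp add: increasing_run_def)
  obtain j where j: "set xs \<subseteq> run_balls u j" using contiguous_same_run[OF assms c] by blast
  define ys where "ys = sorted_list_of_set (run_balls u j)"
  have sy: "set ys = run_balls u j" by (simp add: ys_def)
  have xs0: "xs \<noteq> []" using c by (simp add: contiguous_increasing_def)
  then have ne: "run_balls u j \<noteq> {}" using j by auto
  then have cy: "contiguous_increasing (length u) (conf u) ys"
    unfolding ys_def by (rule run_contiguous[OF assms])
  obtain a where a: "\<And>k. k < length xs \<Longrightarrow> conf u (a + int k) = xs ! k"
    using c by (auto simp: contiguous_increasing_def)
  obtain a' where a': "\<And>k. k < length ys \<Longrightarrow> conf u (a' + int k) = ys ! k"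
    using cy by (auto simp: contiguous_increasing_def)
  have pos: "\<exists>m < length ys. a + int k = a' + int m" if "k < length xs" for k
  proof -
    have "xs ! k \<in> set ys" using j that sy by auto
    then obtain m where m: "m < length ys" "xs ! k = ys ! m" by (metis in_set_conv_nth)
    then have e: "conf u (a + int k) = conf u (a' + int m)" using a a' that by simp
    have "set xs \<subseteq> {1..length u}" using c by (simp add: contiguous_increasing_def)
    then have "conf u (a + int k) \<le> length u" using nth_mem[OF that] a[OF that] by auto
    then have "a + int k \<in> set u" using conf_in_iff by blast
    then show ?thesis using conf_inj[OF e] m by blast
  qed
  obtain m where m: "m < length ys" "a = a' + int m" using pos[of 0] xs0 by auto
  obtain m' where "m' < length ys" "a + int (length xs - 1) = a' + int m'"
    using pos[of "length xs - 1"] xs0 by auto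
  then have len: "m + length xs \<le> length ys" using m xs0 by (cases xs) auto
  have "xs = take (length xs) (drop m ys)"
  proof (rule nth_equalityI)
    fix k assume k: "k < length xs"
    then have "xs ! k = ys ! (m + k)" using a[OF k] a'[of "m + k"] len m by (simp add: algebra_simps)
    then show "xs ! k = take (length xs) (drop m ys) ! k" using k len by simp
  qed (use len in simp)
  then have "sublist xs ys"
    by (metis append_take_drop_id sublist_appendI)
  then have "ys = xs" using R cy by (simp add: increasing_run_def)
  then show "\<exists>j. run_balls u j \<noteq> {} \<and> xs = sorted_list_of_set (run_balls u j)"
    using ne ys_def by blast
next
  assume "\<exists>j. run_balls u j \<noteq> {} \<and> xs = sorted_list_of_set (run_balls u j)"
  then obtain j where j: "run_balls u j \<noteq> {}" "xs = sorted_list_of_set (run_balls u j)" by blast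
  have sx: "set xs = run_balls u j" using j by simp
  have "zs = xs" if zs: "contiguous_increasing (length u) (conf u) zs" "sublist xs zs" for zs
  proof -
    obtain j' where j': "set zs \<subseteq> run_balls u j'" using contiguous_same_run[OF assms zs(1)] by blast
    have sub: "set xs \<subseteq> set zs" using zs(2) by (rule set_mono_sublist)
    then have "j' = j" using j(1) sx j' by (fastforce simp: run_balls_def)
    then have "set zs = set xs" using sub sx j' by blast
    moreover have "sorted_wrt (<) zs" using zs(1) by (simp add: contiguous_increasing_def)
    ultimately show ?thesis
      using j(2) by (metis strict_sorted_equal strict_sorted_list_of_set)
  qed
  then show "increasing_run (length u) (conf u) xs"
    using run_contiguous[OF assms j(1)] j(2) by (simp add: increasing_run_def)
qed

lemma soliton_conf_iff:
  assumes "distinct u"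
  shows "soliton (length u) (conf u) xs \<longleftrightarrow> (\<forall>t. increasing_run (length u) (conf ((move ^^ t) u)) xs)"
  by (simp add: soliton_def funpow_BB_conf[OF assms])

lemma increasing_run_funpow_move_iff:
  assumes "distinct u"
  shows "increasing_run (length u) (conf ((move ^^ t) u)) xs \<longleftrightarrow>
    (\<exists>j. run_balls ((move ^^ t) u) j \<noteq> {} \<and> xs = sorted_list_of_set (run_balls ((move ^^ t) u) j))"
  using increasing_run_conf_iff[of "(move ^^ t) u" xs] funpow_move[OF assms] by simp

lemma run_balls_settled:
  assumes "distinct u" "settled u"
  shows "run_balls ((move ^^ t) u) j = run_balls u j"
  using settled_run_index[OF assms, of _ t] by (auto simp: run_balls_def funpow_move[OF assms(1)])

lemma increasing_run_imp_soliton: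
  assumes "distinct u" "settled u" "increasing_run (length u) (conf u) xs"
  shows "soliton (length u) (conf u) xs"
  unfolding soliton_conf_iff[OF assms(1)] increasing_run_funpow_move_iff[OF assms(1)]
    run_balls_settled[OF assms(1,2)]
  using assms(3) increasing_run_conf_iff[OF assms(1)] by blast

lemma steady_state_if_settled:
  assumes "distinct u" "settled u"
  shows "steady_state (length u) (conf u)"
  unfolding steady_state_def
proof
  fix b assume b: "b \<in> {1..length u}"
  define j where "j = run_index u (u ! (b - 1))"
  have "b \<in> run_balls u j" using b by (simp add: run_balls_def j_def)
  moreover have "soliton (length u) (conf u) (sorted_list_of_set (run_balls u j))"
    using increasing_run_imp_soliton[OF assms] increasing_run_conf_iff[OF assms(1)] calculation by blast
  ultimately show "\<exists>xs. soliton (length u) (conf u) xs \<and> b \<in> set xs"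
    using set_sorted_list_of_set[OF finite_run_balls] by blast
qed

lemma steady_state_move:
  assumes "distinct u" "steady_state (length u) (conf u)"
  shows "steady_state (length u) (conf (move u))"
proof -
  have "soliton (length u) (conf (move u)) xs" if "soliton (length u) (conf u) xs" for xs
  proof -
    have "increasing_run (length u) (conf ((move ^^ t) (move u))) xs" for t
      using that[unfolded soliton_conf_iff[OF assms(1)], rule_format, of "Suc t"]
      by (simp add: funpow_swap1)
    then show ?thesis
      using soliton_conf_iff[OF distinct_move[OF assms(1)]] by simp
  qed
  then show ?thesis using assms(2) unfolding steady_state_def by blast
qed

text \<open>In steady state the runs before and after a move consist of the same balls. So the run index
after the move is an injective function of the run index before; it is not smaller than the old
index and takes values in the same range, hence it is the identity.\<close>

lemma index_sum_move_steady:
  assumes d: "distinct u" and st: "steady_state (length u) (conf u)"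
  shows "index_sum (move u) = index_sum u"
proof -
  let ?n = "length u" and ?M = "card (run_starts u)"
  let ?r = "\<lambda>k. run_index u (u ! k)" and ?r' = "\<lambda>k. run_index (move u) (move u ! k)"
  have le: "?r k \<le> ?r' k" if "k < ?n" for k using run_index_move(1)[OF d that] .
  have same: "?r k = ?r l" if kl: "k < ?n" "l < ?n" "?r' k = ?r' l" for k l
  proof -
    have "Suc k \<in> {1..?n}" using kl by simp
    then obtain xs where xs: "soliton ?n (conf u) xs" "Suc k \<in> set xs"
      using st unfolding steady_state_def by blast
    have xs01: "increasing_run ?n (conf u) xs" "increasing_run ?n (conf (move u)) xs"
      using xs(1)[unfolded soliton_conf_iff[OF d], rule_format, of 0]
        xs(1)[unfolded soliton_conf_iff[OF d], rule_format, of 1] by simp_all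
    obtain j where "xs = sorted_list_of_set (run_balls u j)"
      using xs01(1) increasing_run_conf_iff[OF d] by blast
    then have j: "set xs = run_balls u j" by simp
    obtain j' where "xs = sorted_list_of_set (run_balls (move u) j')"
      using xs01(2) increasing_run_conf_iff[OF distinct_move[OF d]] by (simp only: length_move) blast
    then have j': "set xs = run_balls (move u) j'" by simp
    have "j' = ?r' k" using xs(2) unfolding j' run_balls_def by simp
    then have "Suc l \<in> set xs" using kl unfolding j' run_balls_def by simp
    then show ?thesis using xs(2) unfolding j run_balls_def by simp
  qed
  have "?r k = ?r' k" if "k < ?n" for k
  proof (rule ccontr)
    assume "?r k \<noteq> ?r' k"
    \<comment> \<open>Among the balls whose run index grows, take one with the largest old index; the ball that had its new index before keeps it, so both would share a run.\<close>
    define K where "K = {k. k < ?n \<and> ?r k < ?r' k}"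
    have K: "finite (?r ` K)" "?r ` K \<noteq> {}" using that \<open>?r k \<noteq> ?r' k\<close> le[OF that] by (auto simp: K_def)
    obtain k where k: "k \<in> K" "Max (?r ` K) = ?r k" using Max_in[OF K] by (rule imageE)
    have max: "?r l \<le> ?r k" if "l \<in> K" for l
      unfolding k(2)[symmetric] by (rule Max_ge[OF K(1)]) (rule imageI[OF that])
    have k': "k < ?n" "?r k < ?r' k" using k by (auto simp: K_def)
    have "?r' k \<le> ?M" using run_index_le[of "move u"] run_index_move(2)[OF d] by simp
    then have "?r' k \<in> run_index u ` run_starts u"
      unfolding run_index_image_starts using k'(2) by simp
    then obtain s where "s \<in> set u" "run_index u s = ?r' k" using run_starts_subset[of u] by auto
    then obtain l where l: "l < ?n" "?r l = ?r' k" by (metis in_set_conv_nth)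
    then have "l \<notin> K" using max[of l] k'(2) by auto
    then have "?r' l = ?r l" using l le[of l] by (simp add: K_def)
    then have "?r k = ?r l" using same[OF k'(1) l(1)] l(2) by simp
    then show False using k'(2) l(2) by simp
  qed
  then show ?thesis using index_sum_move(2)[OF d] by simp
qed

theorem steady_state_conf_iff:
  assumes "distinct u"
  shows "steady_state (length u) (conf u) \<longleftrightarrow> settled u"
proof
  assume st: "steady_state (length u) (conf u)"
  have "steady_state (length u) (conf ((move ^^ t) u)) \<and> index_sum ((move ^^ t) u) = index_sum u" for t
  proof (induction t)
    case (Suc t)
    have v: "distinct ((move ^^ t) u)" "length ((move ^^ t) u) = length u"
      using funpow_move[OF assms] by simp_all
    show ?case
      using steady_state_move[OF v(1)] index_sum_move_steady[OF v(1)] v(2) Suc by simp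
  qed (simp add: st)
  then show "settled u" by (simp add: settled_def)
qed (rule steady_state_if_settled[OF assms])

section \<open>The tableau of runs\<close>

text \<open>The rows of the soliton decomposition of a steady configuration; here they are defined for all
configurations, as their behaviour under Knuth equivalence does not depend on the dynamics.\<close>

definition runs_right_to_left :: "int list \<Rightarrow> nat list list" where
  "runs_right_to_left u =
     map (\<lambda>j. sorted_list_of_set (run_balls u j)) (rev [1..<Suc (card (run_starts u))])"

lemma run_balls_nonempty_iff:
  assumes "distinct u"
  shows "run_balls u j \<noteq> {} \<longleftrightarrow> j \<in> {1..card (run_starts u)}"
proof
  assume "run_balls u j \<noteq> {}"
  then obtain b where b: "b \<in> {1..length u}" "run_index u (u ! (b - 1)) = j" by (auto simp: run_balls_def)
  let ?p = "u ! (b - 1)" and ?m = "Min (set u)"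
  have "b - 1 < length u" using b(1) by auto
  then have "?p \<in> set u" by simp
  then have m: "?m \<in> set u" "?m \<le> ?p" using Min_in[of "set u"] Min_le[of "set u"] by fastforce+
  have "?m - 1 \<notin> set u" using Min_le[of "set u" "?m - 1"] by auto
  then have "?m \<in> run_starts u"
    using conf_in_le[OF m(1)] by (simp add: run_starts_def conf_notin)
  then have "run_index u (?m - 1) < run_index u ?p" by (intro run_index_less[of _ ?m]) (use m in auto)
  then show "j \<in> {1..card (run_starts u)}" using b(2) run_index_le[of u ?p] by auto
next
  assume "j \<in> {1..card (run_starts u)}"
  then have "j \<in> run_index u ` run_starts u" unfolding run_index_image_starts .
  then obtain s where s: "s \<in> set u" "run_index u s = j" using run_starts_subset[of u] by auto
  then obtain k where "k < length u" "u ! k = s" by (metis in_set_conv_nth)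
  then have "Suc k \<in> run_balls u j" using s by (simp add: run_balls_def)
  then show "run_balls u j \<noteq> {}" by blast
qed

lemma (in linorder) sorted_key_list_of_set_eqI:
  assumes "sorted_wrt (<) (map f xs)"
  shows "sorted_key_list_of_set f (set xs) = xs"
proof -
  have d: "sorted (map f xs)" "distinct (map f xs)" using assms by (auto simp: strict_sorted_iff)
  then interpret folding_insort_key "(\<le>)" "(<)" "set xs" f
    by unfold_locales (simp add: distinct_map)
  show ?thesis using idem_if_sorted_distinct[of xs] d by (simp add: distinct_map)
qed

lemma solitons_right_to_left_settled:
  assumes d: "distinct u" and s: "settled u"
  shows "solitons_right_to_left (length u) (conf u) = runs_right_to_left u"
proof -
  let ?n = "length u" and ?M = "card (run_starts u)"
  let ?row = "\<lambda>j. sorted_list_of_set (run_balls u j)"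
  let ?f = "\<lambda>xs. - ball_pos (conf u) (hd xs)"
  have "soliton ?n (conf u) xs \<longleftrightarrow> increasing_run ?n (conf u) xs" for xs
    using increasing_run_imp_soliton[OF d s] soliton_conf_iff[OF d, of xs] by (metis funpow_0)
  then have set: "{xs. soliton ?n (conf u) xs} = set (runs_right_to_left u)"
    unfolding increasing_run_conf_iff[OF d] run_balls_nonempty_iff[OF d] runs_right_to_left_def
    by auto
  have ri: "run_index u (ball_pos (conf u) (hd (?row j))) = j" if "j \<in> {1..?M}" for j
  proof -
    have "run_balls u j \<noteq> {}" using that run_balls_nonempty_iff[OF d] by blast
    then have "hd (?row j) \<in> run_balls u j"
      using set_sorted_list_of_set[OF finite_run_balls[of u j]] by (metis hd_in_set set_empty)
    then show ?thesis using ball_pos_conf[OF d, of "hd (?row j)"] by (simp add: run_balls_def)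
  qed
  have less: "?f (?row j) < ?f (?row i)" if "i \<in> {1..?M}" "j \<in> {1..?M}" "i < j" for i j
    using run_index_mono[of "ball_pos (conf u) (hd (?row j))" "ball_pos (conf u) (hd (?row i))" u]
      ri[OF that(1)] ri[OF that(2)] that(3) by fastforce
  have "sorted_wrt (\<lambda>i j. ?f (?row j) < ?f (?row i)) [1..<Suc ?M]"
    by (rule sorted_wrt_mono_rel[OF _ sorted_wrt_upt]) (use less in auto)
  then have "sorted_wrt (<) (map ?f (runs_right_to_left u))"
    unfolding runs_right_to_left_def by (simp only: sorted_wrt_map sorted_wrt_rev)
  then show ?thesis
    unfolding solitons_right_to_left_def set by (rule sorted_key_list_of_set_eqI)
qed

section \<open>Exchange of two consecutive balls\<close>

text \<open>Both Knuth relations swap two neighbouring entries \<open>x\<close> and \<open>y\<close> while some \<open>z\<close> between them is the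
entry just before or just after the pair. For configurations this exchanges two balls \<open>a\<close> and
\<open>a + 1\<close> that have ball \<open>a - 1\<close> or \<open>a + 2\<close> somewhere between their boxes.\<close>

definition dual_step :: "int list \<Rightarrow> int list \<Rightarrow> bool" where
  "dual_step u v \<longleftrightarrow> distinct u \<and> (\<exists>l x y r z. u = l @ [x, y] @ r \<and> v = l @ [y, x] @ r \<and>
     (x < z \<and> z < y \<or> y < z \<and> z < x) \<and> (l \<noteq> [] \<and> z = last l \<or> r \<noteq> [] \<and> z = hd r))"

lemma dual_stepI:
  assumes "distinct (l @ [x, y] @ r)" "x < z \<and> z < y \<or> y < z \<and> z < x"
    "l \<noteq> [] \<and> z = last l \<or> r \<noteq> [] \<and> z = hd r"
  shows "dual_step (l @ [x, y] @ r) (l @ [y, x] @ r)"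
  unfolding dual_step_def using assms by blast

lemma dual_stepE:
  assumes "dual_step u v"
  obtains a z where "a \<in> {1..<length u}"
    "\<And>p. conf v p = transpose a (Suc a) (conf u p)" "z \<in> set u"
    "conf u z + 1 = a \<or> conf u z = a + 2"
    "u ! (a - 1) < z \<and> z < u ! a \<or> u ! a < z \<and> z < u ! (a - 1)"
proof -
  obtain l x y r z where u: "u = l @ [x, y] @ r" and v: "v = l @ [y, x] @ r" and d: "distinct u"
    and z: "x < z \<and> z < y \<or> y < z \<and> z < x" "l \<noteq> [] \<and> z = last l \<or> r \<noteq> [] \<and> z = hd r"
    using assms unfolding dual_step_def by blast
  let ?a = "Suc (length l)"
  have "conf v p = transpose ?a (Suc ?a) (conf u p)" for p
  proof -
    consider "p \<in> set l" | "p = x" | "p = y" | "p \<notin> set l" "p \<noteq> x" "p \<noteq> y" by blast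
    then show ?thesis
    proof cases
      case 1
      then show ?thesis using conf_in_le[of p l] by (simp add: u v conf_append transpose_def)
    next
      case 4
      then show ?thesis using conf_greater_0[of r p] by (simp add: u v conf_append transpose_def)
    qed (use d in \<open>auto simp: u v conf_append transpose_def\<close>)
  qed
  moreover have "conf u z + 1 = ?a \<or> conf u z = ?a + 2"
    using z(2)
  proof
    assume "l \<noteq> [] \<and> z = last l"
    then have "z = u ! (length l - 1)" "length l > 0" by (simp_all add: u nth_append last_conv_nth)
    then have "conf u z = Suc (length l - 1)" using conf_nth[OF d, of "length l - 1"] by (simp add: u)
    then show ?thesis using \<open>length l > 0\<close> by simp
  next
    assume "r \<noteq> [] \<and> z = hd r"
    then have "z = u ! (length l + 2)" "length l + 2 < length u"
      by (simp_all add: u nth_append hd_conv_nth)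
    then show ?thesis using conf_nth[OF d, of "length l + 2"] by simp
  qed
  moreover have "z \<in> set u" using z(2) by (auto simp: u)
  ultimately show ?thesis using that[of ?a z] z(1) by (simp add: u nth_append)
qed

lemma dual_step_sym: "dual_step u v \<Longrightarrow> dual_step v u"
proof -
  assume "dual_step u v"
  then obtain l x y r z where "u = l @ [x, y] @ r" "v = l @ [y, x] @ r" "distinct u"
    "x < z \<and> z < y \<or> y < z \<and> z < x" "l \<noteq> [] \<and> z = last l \<or> r \<noteq> [] \<and> z = hd r"
    unfolding dual_step_def by blast
  then show "dual_step v u"
    using dual_stepI[of l y x r z] by auto
qed

lemma knuth_eq_invariant:
  assumes "knuth_eq u v" "distinct u" "\<And>u v. dual_step u v \<Longrightarrow> f u = f v"
  shows "f u = f v"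
  using assms(1,2)
proof (induction rule: knuth_eq.induct)
  case (bac a b c l r)
  then have "dual_step (l @ [b, a, c] @ r) (l @ [b, c, a] @ r)"
    using dual_stepI[of "l @ [b]" a c r b] by simp
  then show ?case by (rule assms(3))
next
  case (acb a b c l r)
  then have "dual_step (l @ [a, c, b] @ r) (l @ [c, a, b] @ r)"
    using dual_stepI[of l a c "b # r" b] by simp
  then show ?case by (rule assms(3))
next
  case (sym u v)
  then show ?case using knuth_eq_same_entries[OF sym(1)] by simp
next
  case (trans u v w)
  then show ?case using knuth_eq_same_entries[OF trans(1)] by simp
qed simp

lemma transpose_Suc_less_iff:
  "{i, j} \<noteq> {a, Suc a} \<Longrightarrow> transpose a (Suc a) i < transpose a (Suc a) j \<longleftrightarrow> i < j"
  by (auto simp: transpose_def)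

text \<open>The exchanged balls are not in adjacent boxes, so no comparison between adjacent boxes changes.\<close>

lemma dual_step_same_boxes:
  assumes "dual_step u v"
  shows "run_starts v = run_starts u" "set v = set u" "distinct u" "distinct v" "length v = length u"
proof -
  show d: "distinct u" using assms by (simp add: dual_step_def)
  show "distinct v" using dual_step_sym[OF assms] by (simp add: dual_step_def)
  show "set v = set u" "length v = length u" using assms by (auto simp: dual_step_def)
  obtain a z where a: "a \<in> {1..<length u}" "\<And>p. conf v p = transpose a (Suc a) (conf u p)"
    "u ! (a - 1) < z \<and> z < u ! a \<or> u ! a < z \<and> z < u ! (a - 1)"
    using dual_stepE[OF assms] by metis
  have "{conf u p, conf u (p - 1)} \<noteq> {a, Suc a}" for p
  proof
    assume "{conf u p, conf u (p - 1)} = {a, Suc a}"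
    then have "conf u p = a \<and> conf u (p - 1) = Suc a \<or> conf u p = Suc a \<and> conf u (p - 1) = a"
      by (auto simp: doubleton_eq_iff)
    moreover have "a \<in> {1..length u}" "Suc a \<in> {1..length u}" using a(1) by auto
    ultimately have "p = u ! (a - 1) \<and> p - 1 = u ! a \<or> p = u ! a \<and> p - 1 = u ! (a - 1)"
      using conf_eq_iff[OF d] by simp
    then show False using a(3) by auto
  qed
  then show "run_starts v = run_starts u"
    unfolding run_starts_def a(2) by (simp add: transpose_Suc_less_iff)
qed

lemma dual_step_run_index:
  assumes "dual_step u v"
  shows "run_index v p = run_index u p"
  by (simp add: run_index_def dual_step_same_boxes(1)[OF assms])

lemma knuth_eq_index_sum:
  assumes "knuth_eq u v" "distinct u"
  shows "index_sum u = index_sum v"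
  using assms
  by (rule knuth_eq_invariant)
    (simp add: index_sum_def dual_step_run_index dual_step_same_boxes)

lemma knuth_eq_settled:
  assumes "knuth_eq u v" "distinct u"
  shows "settled u \<longleftrightarrow> settled v"
proof -
  have "index_sum ((move ^^ t) u) = index_sum ((move ^^ t) v)" for t
    using knuth_eq_index_sum[OF knuth_eq_funpow_move[OF assms]] funpow_move[OF assms(2)] by simp
  from this this[of 0] show ?thesis by (simp add: settled_def)
qed

text \<open>The two balls cannot lie in the same run either, since the third ball between their boxes would
have to lie between them in value. Therefore renaming keeps every run sorted.\<close>

lemma dual_step_runs:
  assumes "dual_step u v"
    and a: "a \<in> {1..<length u}" "\<And>p. conf v p = transpose a (Suc a) (conf u p)"
    and z: "z \<in> set u" "conf u z + 1 = a \<or> conf u z = a + 2"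
    "u ! (a - 1) < z \<and> z < u ! a \<or> u ! a < z \<and> z < u ! (a - 1)"
  shows "runs_right_to_left v = map (map (transpose a (Suc a))) (runs_right_to_left u)"
proof -
  let ?s = "transpose a (Suc a)"
  note dv = dual_step_same_boxes[OF assms(1)]
  have s_in: "?s b \<in> {1..length u} \<longleftrightarrow> b \<in> {1..length u}" for b
    using a(1) by (auto simp: transpose_def)
  have pos: "v ! (b - 1) = u ! (?s b - 1)" if b: "b \<in> {1..length u}" for b
  proof -
    have "b \<in> {1..length v}" using b dv(5) by simp
    then have "conf v (v ! (b - 1)) = b" using conf_eq_iff[OF dv(4), of b] by simp
    then have "conf u (v ! (b - 1)) = ?s b" using a(2) by (metis transpose_involutory)
    then show ?thesis using conf_eq_iff[OF dv(3), of "?s b"] s_in b by simp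
  qed
  have mem: "b \<in> run_balls v j \<longleftrightarrow> ?s b \<in> run_balls u j" for b j
    using pos[of b] s_in[of b] dv(5) by (auto simp: run_balls_def dual_step_run_index[OF assms(1)])
  have img: "run_balls v j = ?s ` run_balls u j" for j
  proof (intro equalityI subsetI)
    fix b assume "b \<in> run_balls v j"
    then have "?s b \<in> run_balls u j" using mem by simp
    then show "b \<in> ?s ` run_balls u j" by (metis image_eqI transpose_involutory)
  qed (auto simp: mem)
  have sep: "\<not> (a \<in> run_balls u j \<and> Suc a \<in> run_balls u j)" for j
  proof
    assume "a \<in> run_balls u j \<and> Suc a \<in> run_balls u j"
    then have e: "run_index u (u ! (a - 1)) = run_index u (u ! a)" by (simp add: run_balls_def)
    have c: "conf u (u ! (a - 1)) = a" "conf u (u ! a) = Suc a"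
      using conf_nth[OF dv(3), of "a - 1"] conf_nth[OF dv(3), of a] a(1) by auto
    have "a \<le> conf u z \<and> conf u z \<le> Suc a \<or> Suc a \<le> conf u z \<and> conf u z \<le> a"
      using z(3)
    proof
      assume lt: "u ! (a - 1) < z \<and> z < u ! a"
      then show ?thesis
        using same_run_conf_mono[OF e, of "u ! (a - 1)" z] same_run_conf_mono[OF e, of z "u ! a"] c by simp
    next
      assume lt: "u ! a < z \<and> z < u ! (a - 1)"
      then show ?thesis
        using same_run_conf_mono[OF e[symmetric], of "u ! a" z]
          same_run_conf_mono[OF e[symmetric], of z "u ! (a - 1)"] c by simp
    qed
    then show False using z(2) by auto
  qed
  have "sorted_list_of_set (run_balls v j) = map ?s (sorted_list_of_set (run_balls u j))" for j
  proof -
    have "sorted_wrt (\<lambda>b c. ?s b < ?s c) (sorted_list_of_set (run_balls u j))"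
    proof (rule sorted_wrt_mono_rel[OF _ strict_sorted_list_of_set])
      fix b c assume "b \<in> set (sorted_list_of_set (run_balls u j))"
        "c \<in> set (sorted_list_of_set (run_balls u j))" "b < c"
      then have "{b, c} \<noteq> {a, Suc a}" using sep[of j] by (auto simp: doubleton_eq_iff)
      then show "?s b < ?s c" using \<open>b < c\<close> transpose_Suc_less_iff by blast
    qed
    then have "sorted_wrt (<) (map ?s (sorted_list_of_set (run_balls u j)))"
      by (simp add: sorted_wrt_map)
    then show ?thesis
      by (intro strict_sorted_equal) (simp_all add: img)
  qed
  then show ?thesis by (simp add: runs_right_to_left_def dv(1))
qed

text \<open>The exchange could only destroy a column in which \<open>a\<close> stands directly above \<open>a + 1\<close>. Then
ball \<open>a - 1\<close> or \<open>a + 2\<close> would lie in box \<open>z\<close> between them, that is, to the right of \<open>a + 1\<close> in its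
row or to the left of \<open>a\<close> in its row. In the first case it is \<open>a + 2\<close>, and the entry above it would
lie strictly between \<open>a\<close> and \<open>a + 2\<close>; in the second case it is \<open>a - 1\<close>, and the entry below it would
lie strictly between \<open>a - 1\<close> and \<open>a + 1\<close>. Both entries are already in use elsewhere.\<close>

lemma standard_tableau_dual_step:
  assumes ds: "dual_step u v" and T: "standard_tableau (length u) (runs_right_to_left u)"
  shows "standard_tableau (length u) (runs_right_to_left v)"
proof -
  let ?T = "runs_right_to_left u" and ?M = "card (run_starts u)"
  obtain a z where az: "a \<in> {1..<length u}" "\<And>p. conf v p = transpose a (Suc a) (conf u p)"
    "z \<in> set u" "conf u z + 1 = a \<or> conf u z = a + 2"
    "u ! (a - 1) < z \<and> z < u ! a \<or> u ! a < z \<and> z < u ! (a - 1)"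
    using dual_stepE[OF ds] by metis
  let ?s = "transpose a (Suc a)" and ?pos = "\<lambda>b. u ! (b - 1)"
  note dv = dual_step_same_boxes[OF ds]
  have eq: "runs_right_to_left v = map (map ?s) ?T" by (rule dual_step_runs[OF ds az])
  have lenT: "length ?T = ?M" by (simp add: runs_right_to_left_def del: upt_Suc)
  have row: "?T ! i = sorted_list_of_set (run_balls u (?M - i))" if "i < ?M" for i
    using that by (simp add: runs_right_to_left_def rev_nth Suc_diff_Suc del: upt_Suc)
  have mem: "b \<in> set (?T ! i) \<longleftrightarrow> b \<in> {1..length u} \<and> run_index u (?pos b) = ?M - i" if "i < ?M" for b i
    using row[OF that] by (simp add: run_balls_def)
  have srt: "sorted_wrt (<) (?T ! i)" if "i < ?M" for i
    using row[OF that] by simp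
  have conf_pos: "conf u (?pos b) = b" if "b \<in> {1..length u}" for b
    using conf_eq_iff[OF dv(3) that] by simp
  have col: "?T ! i ! j < ?T ! Suc i ! j" if "Suc i < ?M" "j < length (?T ! Suc i)" for i j
    using T that lenT by (simp add: standard_tableau_def)
  have len: "length (?T ! Suc i) \<le> length (?T ! i)" if "Suc i < ?M" for i
  proof -
    have "sorted_wrt (\<ge>) (map length ?T)" using T by (simp add: standard_tableau_def shape_def)
    then show ?thesis using sorted_wrt_nth_less[of "(\<ge>)" "map length ?T" i "Suc i"] that lenT by simp
  qed
  have sep: False
    if ij: "Suc i < ?M" "j < length (?T ! Suc i)" "?T ! i ! j = a" "?T ! Suc i ! j = Suc a" for i j
  proof -
    have ja: "j < length (?T ! i)" using len ij by fastforce
    have "a \<in> set (?T ! i)" "Suc a \<in> set (?T ! Suc i)"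
      using ij(3,4) ja ij(2) by (metis nth_mem)+
    then have ri: "run_index u (?pos a) = ?M - i" "run_index u (?pos (Suc a)) = ?M - Suc i"
      using mem[of i] mem[of "Suc i"] ij(1) by simp_all
    have "\<not> ?pos a \<le> ?pos (Suc a)" using run_index_mono[of "?pos a" "?pos (Suc a)" u] ri ij(1) by auto
    then have btw: "?pos (Suc a) < z" "z < ?pos a" using az(5) by auto
    define c where "c = conf u z"
    have c: "c \<in> {1..length u}" "?pos c = z"
      using conf_in_le[OF az(3)] conf_pos az(3) nth_conf[OF az(3)] conf_greater_0[of u z] by (auto simp: c_def)
    have "run_index u (?pos (Suc a)) \<le> run_index u z" "run_index u z \<le> run_index u (?pos a)"
      using btw by (intro run_index_mono; simp)+
    then have "run_index u z = ?M - Suc i \<or> run_index u z = ?M - i" using ri ij(1) by auto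
    then show False
    proof
      assume rz: "run_index u z = ?M - Suc i"
      then have e: "run_index u (?pos (Suc a)) = run_index u z" using ri by simp
      have "conf u (?pos (Suc a)) \<le> conf u z"
        by (rule same_run_conf_mono[OF e]) (use btw in auto)
      then have ca: "c = a + 2" using conf_pos[of "Suc a"] az(1,4) by (auto simp: c_def)
      have "c \<in> set (?T ! Suc i)" using mem[OF ij(1)] c rz by simp
      then obtain k where k: "k < length (?T ! Suc i)" "?T ! Suc i ! k = c" by (metis in_set_conv_nth)
      have "j < k"
      proof (rule ccontr)
        assume "\<not> j < k"
        then have "k < j \<or> k = j" by auto
        then show False using sorted_wrt_nth_less[OF srt[OF ij(1)], of k j] ij k ca by auto
      qed
      have kl: "k < length (?T ! i)" using k(1) len[OF ij(1)] by simp
      have "a < ?T ! i ! k" using sorted_wrt_nth_less[OF srt, of i j k] ij \<open>j < k\<close> kl by simp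
      moreover have "?T ! i ! k < a + 2" using col[OF ij(1) k(1)] k(2) ca by simp
      ultimately have "?T ! i ! k = Suc a" by simp
      then have "Suc a \<in> set (?T ! i)" using kl by (metis nth_mem)
      then show False using mem[of i "Suc a"] ri(2) ij(1) by simp
    next
      assume rz: "run_index u z = ?M - i"
      then have e: "run_index u z = run_index u (?pos a)" using ri by simp
      have "conf u z \<le> conf u (?pos a)"
        by (rule same_run_conf_mono[OF e]) (use btw in auto)
      then have ca: "c + 1 = a" using conf_pos[of a] az(1,4) by (auto simp: c_def)
      have "c \<in> set (?T ! i)" using mem[of i c] ij(1) c rz by simp
      then obtain k where k: "k < length (?T ! i)" "?T ! i ! k = c" by (metis in_set_conv_nth)
      have "k < j"
      proof (rule ccontr)
        assume "\<not> k < j"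
        then have "j < k \<or> k = j" by auto
        then show False using sorted_wrt_nth_less[OF srt, of i j k] ij k ca by auto
      qed
      then have kl: "k < length (?T ! Suc i)" using ij(2) by simp
      have "?T ! Suc i ! k < Suc a" using sorted_wrt_nth_less[OF srt[OF ij(1)], of k j] ij \<open>k < j\<close> by simp
      moreover have "c < ?T ! Suc i ! k" using col[OF ij(1) kl] k(2) by simp
      ultimately have "?T ! Suc i ! k = a" using ca by simp
      then have "a \<in> set (?T ! Suc i)" using kl by (metis nth_mem)
      then show False using mem[OF ij(1), of a] ri(1) ij(1) by simp
    qed
  qed
  have cols: "map (map ?s) ?T ! i ! j < map (map ?s) ?T ! Suc i ! j"
    if ij: "Suc i < ?M" "j < length (?T ! Suc i)" for i j
  proof -
    have "{?T ! i ! j, ?T ! Suc i ! j} \<noteq> {a, Suc a}"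
      using sep[OF ij] col[OF ij] by (auto simp: doubleton_eq_iff)
    then have "?s (?T ! i ! j) < ?s (?T ! Suc i ! j)"
      using transpose_Suc_less_iff col[OF ij] by blast
    then show ?thesis using ij len[OF ij(1)] lenT by simp
  qed
  have "shape (map (map ?s) ?T) = shape ?T" by (simp add: shape_def)
  moreover have "concat (map (map ?s) ?T) = map ?s (concat ?T)" by (simp add: map_concat)
  moreover have "?s ` {1..length u} = {1..length u}"
    by (rule transpose_image_eq) (use az(1) in auto)
  moreover have "\<forall>r \<in> set (runs_right_to_left v). sorted_wrt (<) r"
    by (auto simp: runs_right_to_left_def)
  moreover have "inj_on ?s A" for A by (rule inj_on_subset[OF inj_transpose]) simp
  ultimately show ?thesis
    using T cols lenT unfolding standard_tableau_def eq by (auto simp: distinct_map)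
qed

lemma dual_step_shape:
  assumes "dual_step u v"
  shows "shape (runs_right_to_left u) = shape (runs_right_to_left v)"
proof -
  obtain a z where az: "a \<in> {1..<length u}" "\<And>p. conf v p = transpose a (Suc a) (conf u p)"
    "z \<in> set u" "conf u z + 1 = a \<or> conf u z = a + 2"
    "u ! (a - 1) < z \<and> z < u ! a \<or> u ! a < z \<and> z < u ! (a - 1)"
    using dual_stepE[OF assms] by metis
  show ?thesis unfolding dual_step_runs[OF assms az] by (simp add: shape_def)
qed

lemma knuth_eq_run_tableau:
  assumes "knuth_eq u v" "distinct u"
  shows "shape (runs_right_to_left u) = shape (runs_right_to_left v)"
    "standard_tableau (length u) (runs_right_to_left u) \<longleftrightarrow>
      standard_tableau (length v) (runs_right_to_left v)"
proof -
  show "shape (runs_right_to_left u) = shape (runs_right_to_left v)"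
    by (rule knuth_eq_invariant[OF assms]) (rule dual_step_shape)
  show "standard_tableau (length u) (runs_right_to_left u) \<longleftrightarrow>
      standard_tableau (length v) (runs_right_to_left v)"
  proof (rule knuth_eq_invariant[OF assms])
    fix u v :: "int list" assume ds: "dual_step u v"
    show "standard_tableau (length u) (runs_right_to_left u) =
      standard_tableau (length v) (runs_right_to_left v)"
      using standard_tableau_dual_step[OF ds] standard_tableau_dual_step[OF dual_step_sym[OF ds]]
        dual_step_same_boxes(5)[OF ds] by auto
  qed
qed

section \<open>Permutations with the same recording tableau\<close>

definition ball_positions :: "nat \<Rightarrow> (nat \<Rightarrow> nat) \<Rightarrow> int list" where
  "ball_positions n w = map int (map (inv w) [1..<n + 1])"

lemma ball_positions:
  assumes w: "w permutes {1..n}"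
  shows "distinct (ball_positions n w)" "length (ball_positions n w) = n"
    "conf (ball_positions n w) = perm_config n w"
proof -
  let ?u = "ball_positions n w"
  have "inj (inv w)" using permutes_inj[OF permutes_inv[OF w]] .
  then show d: "distinct ?u"
    by (auto simp: ball_positions_def distinct_map inj_on_def dest: injD)
  show l: "length ?u = n" by (simp add: ball_positions_def)
  have nth: "?u ! (b - 1) = int (inv w b)" if "b \<in> {1..n}" for b
    using that by (auto simp: ball_positions_def simp del: upt_Suc)
  have "conf ?u i = perm_config n w i" for i
  proof (cases "1 \<le> i \<and> i \<le> int n")
    case True
    then have "nat i \<in> {1..n}" by auto
    then have "w (nat i) \<in> {1..n}" using permutes_in_image[OF w] by blast
    moreover have "inv w (w (nat i)) = nat i" by (rule permutes_inverses(2)[OF w])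
    ultimately have "conf ?u i = w (nat i)"
      using conf_eq_iff[OF d, of "w (nat i)" i] nth[of "w (nat i)"] l True by simp
    then show ?thesis using True by (simp add: perm_config_def)
  next
    case False
    have "i \<notin> set ?u"
    proof
      assume "i \<in> set ?u"
      then obtain b where "b \<in> set [1..<n + 1]" "i = int (inv w b)"
        by (auto simp only: ball_positions_def set_map)
      then have "b \<in> {1..n}" by auto
      then have "inv w b \<in> {1..n}" using permutes_in_image[OF permutes_inv[OF w]] by blast
      then show False using False \<open>i = int (inv w b)\<close> by auto
    qed
    then show ?thesis using False conf_notin[of i ?u] l by (auto simp: perm_config_def)
  qed
  then show "conf ?u = perm_config n w" by blast
qed

lemma steady_state_perm_config_iff:
  assumes w: "w permutes {1..n}"
  shows "steady_state n ((BB n ^^ t) (perm_config n w)) \<longleftrightarrow> settled ((move ^^ t) (ball_positions n w))"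
proof -
  note u = ball_positions[OF w]
  have "(BB n ^^ t) (perm_config n w) = conf ((move ^^ t) (ball_positions n w))"
    using funpow_BB_conf[OF u(1), of n t] u by simp
  then show ?thesis
    using steady_state_conf_iff[OF funpow_move(1)[OF u(1)]] funpow_move(2)[OF u(1)] u(2) by simp
qed

lemma SD_eq_runs:
  assumes w: "w permutes {1..n}"
  shows "SD n w = runs_right_to_left ((move ^^ steady_state_time n w) (ball_positions n w))"
proof -
  note u = ball_positions[OF w]
  let ?v = "(move ^^ steady_state_time n w) (ball_positions n w)"
  obtain t where "settled ((move ^^ t) (ball_positions n w))"
    using eventually_settled[OF u(1)] by blast
  then have "settled ?v"
    unfolding steady_state_time_def steady_state_perm_config_iff[OF w] by (rule LeastI)
  moreover have "(BB n ^^ steady_state_time n w) (perm_config n w) = conf ?v"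
    using funpow_BB_conf[OF u(1), of n] u by simp
  ultimately show ?thesis
    unfolding SD_def
    using solitons_right_to_left_settled[OF funpow_move(1)[OF u(1)]] funpow_move(2)[OF u(1)] u(2) by simp
qed

theorem theorem1:
  fixes n :: nat and \<pi> w :: "nat \<Rightarrow> nat"
  assumes "\<pi> permutes {1..n}" and "w permutes {1..n}"
    and "recording_tableau n \<pi> = recording_tableau n w"
  shows "steady_state_time n \<pi> = steady_state_time n w \<and>
    shape (SD n \<pi>) = shape (SD n w) \<and>
    (good n \<pi> \<longleftrightarrow> good n w)"
proof -
  note p = ball_positions[OF assms(1)] and q = ball_positions[OF assms(2)]
  have inj: "distinct (map (inv f) [1..<n + 1])" if "f permutes {1..n}" for f
    using permutes_inj_on[OF permutes_inv[OF that]] by (simp add: distinct_map del: upt_Suc)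
  have "knuth_eq (map (inv \<pi>) [1..<n + 1]) (map (inv w) [1..<n + 1])"
    using knuth_eq_if_insert_list_eq[OF inj[OF assms(1)] inj[OF assms(2)]] assms(3)
    unfolding recording_tableau_eq_insert_inverse[OF assms(1)] recording_tableau_eq_insert_inverse[OF assms(2)]
    by blast
  then have "knuth_eq (ball_positions n \<pi>) (ball_positions n w)"
    unfolding ball_positions_def by (rule knuth_eq_map[rotated]) (simp add: strict_mono_def)
  then have k: "knuth_eq ((move ^^ t) (ball_positions n \<pi>)) ((move ^^ t) (ball_positions n w))" for t
    using knuth_eq_funpow_move p(1) by blast
  note d = funpow_move(1)[OF p(1)]
  have time: "steady_state_time n \<pi> = steady_state_time n w"
    unfolding steady_state_time_def steady_state_perm_config_iff[OF assms(1)]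
      steady_state_perm_config_iff[OF assms(2)] knuth_eq_settled[OF k d] ..
  then show ?thesis
    using knuth_eq_run_tableau[OF k[of "steady_state_time n w"] d]
    by (simp add: good_def SD_eq_runs[OF assms(1)] SD_eq_runs[OF assms(2)]
        funpow_move(2)[OF p(1)] funpow_move(2)[OF q(1)] p(2) q(2))
qed

end
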